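(* Let $W=\langle S|M\rangle$ be a finite rank Coxeter system. Fix $p\in[1,\infty]$. The following are equivalent: (1) The quantum Markov semi-group on $\mathcal{L}(W)$ associated with the word length is gradient-$\mathcal{S}_p$. (2) For all $s,t\in S$ the set $\{\mathbf{w}\in W:\mathbf{w}s=t\mathbf{w}\}$ is finite. (3) The Coxeter system $\langle S|M\rangle$ is small at infinity.
   Context: A finite rank Coxeter system $W=\langle S|M\rangle$ consists of a finite set $S=\{s_1,\dots,s_n\}$ and a symmetric matrix $M=(m_{i,j})$ with $m_{i,j}\in\mathbb{N}\cup\{\infty\}$, $m_{i,i}=1$, $m_{i,j}\ge2$ for $i\ne j$; $W$ is the group generated by $S$ subject to $(s_is_j)^{m_{i,j}}=e$ whenever $m_{i,j}<\infty$. $|\mathbf{w}|=\psi_S(\mathbf{w})$ is the word length with respect to $S$; it is conditionally of negative type, so $\Phi_t(\lambda_{\mathbf w})=e^{-t|\mathbf w|}\lambda_{\mathbf w}$ defines a semi-group $(\Phi_t)_{t\ge0}$ of normal unital completely positive trace preserving maps on the group von Neumann algebra $\mathcal{L}(W)$ (the quantum Markov semi-group associated with the word length). Gradient-$\mathcal{S}_p$: let $\mathbb{C}[W]=\mathrm{span}\{\lambda_{\mathbf w}\}$ and $\Delta(\lambda_{\mathbf w})=|\mathbf w|\lambda_{\mathbf w}$. The semi-group is gradient-$\mathcal{S}_p$ if for all $a,b\in\mathbb{C}[W]$ the map $\Psi^{a,b}(x)=\Delta(axb)+a\Delta(x)b-\Delta(ax)b-a\Delta(xb)$ on $\mathbb{C}[W]$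 extends (via $x\mapsto x\delta_e$) to a bounded operator on $\ell_2(W)$ in the Schatten class $\mathcal{S}_p$, where $\mathcal{S}_\infty$ denotes the compact operators. Small at infinity: let the Cayley graph of $W$ have vertex set $W$ and edges between $\mathbf w$ and $\mathbf ws$, $s\in S$. Write $\mathbf w\le\mathbf v$ if some geodesic from $e$ to $\mathbf v$ passes through $\mathbf w$. An infinite geodesic is a sequence $\alpha=(\alpha_i)_{i\in\mathbb{N}}$ in $W$ such that for every $n$ $(\alpha_0,\dots,\alpha_n)$ is a geodesic (shortest path with consecutive vertices adjacent) from $\alpha_0$ to $\alpha_n$. For $\mathbf w\in W$ either $\mathbf w\le\alpha_i$ for all large $i$ (written $\mathbf w\le\alpha$) or $\mathbf w\not\le\alpha_i$ for all large $i$ (written $\mathbf w\not\le\alpha$). Set $\alpha\sim\beta$ if $\mathbf w\le\alpha\Leftrightarrow\mathbf w\le\beta$ for all $\mathbf w\in W$. Let $\partial(W,S)$ be the set of infinite geodesics modulo $\sim$ and $\overline{(W,S)}=W\cup\partial(W,S)$ with the topology generated by the subbase of sets $\{\alpha\in\overline{(W,S)}:\mathbf w\le\alpha\}$ and $\{\alpha\in\overline{(W,S)}:\mathbf w\not\le\alpha\}$, $\mathbf w\in W$. This is a compactification of $W$ (compact, $W$ open and dense, left translation extends continuously). The Coxeter system is small at infinity if for every sequence $(x_i)$ in $W$ converging to a point $z\in\partial(W,S)$ and every $\mathbf w\in W$ one has $x_i\mathbf w\to z$. *)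

theory Defs
  imports "HOL-Analysis.Analysis" "HOL-Algebra.Group" "HOL-Library.Function_Algebras"
    "HOL-Library.Extended_Nat"
begin

section \<open>Coxeter systems\<close>

text \<open>
  The group with generators S and relators R.  Words are lists of letters, where (a, True)
  stands for the generator a and (a, False) for its formal inverse.
\<close>

inductive pres_eq ::
  "'s set \<Rightarrow> ('s \<times> bool) list set \<Rightarrow> ('s \<times> bool) list \<Rightarrow> ('s \<times> bool) list \<Rightarrow> bool"
  for S R where
  refl: "u \<in> lists (S \<times> UNIV) \<Longrightarrow> pres_eq S R u u"
| sym: "pres_eq S R u v \<Longrightarrow> pres_eq S R v u"
| trans: "pres_eq S R u v \<Longrightarrow> pres_eq S R v w \<Longrightarrow> pres_eq S R u w"
| cancel: "u \<in> lists (S \<times> UNIV) \<Longrightarrow> v \<in> lists (S \<times> UNIV) \<Longrightarrow> a \<in> S \<Longrightarrow>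
    pres_eq S R (u @ [(a, b), (a, \<not> b)] @ v) (u @ v)"
| relator: "u \<in> lists (S \<times> UNIV) \<Longrightarrow> v \<in> lists (S \<times> UNIV) \<Longrightarrow> r \<in> R \<Longrightarrow>
    r \<in> lists (S \<times> UNIV) \<Longrightarrow> pres_eq S R (u @ r @ v) (u @ v)"

definition presented_group ::
  "'s set \<Rightarrow> ('s \<times> bool) list set \<Rightarrow> ('s \<times> bool) list set monoid" where
  "presented_group S R =
    \<lparr> carrier = lists (S \<times> UNIV) // {(u, v). pres_eq S R u v},
      mult = (\<lambda>A B. {w. \<exists>u\<in>A. \<exists>v\<in>B. pres_eq S R (u @ v) w}),
      one = {w. pres_eq S R [] w} \<rparr>"

definition coxeter_matrix :: "'s set \<Rightarrow> ('s \<Rightarrow> 's \<Rightarrow> enat) \<Rightarrow> bool" where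
  "coxeter_matrix S M \<longleftrightarrow>
    (\<forall>s\<in>S. M s s = 1) \<and>
    (\<forall>s\<in>S. \<forall>t\<in>S. s \<noteq> t \<longrightarrow> 2 \<le> M s t) \<and>
    (\<forall>s\<in>S. \<forall>t\<in>S. M s t = M t s)"

definition coxeter_relators :: "'s set \<Rightarrow> ('s \<Rightarrow> 's \<Rightarrow> enat) \<Rightarrow> ('s \<times> bool) list set" where
  "coxeter_relators S M =
    {concat (replicate k [(s, True), (t, True)]) | s t k. s \<in> S \<and> t \<in> S \<and> M s t = enat k}"

definition coxeter_group ::
  "'s set \<Rightarrow> ('s \<Rightarrow> 's \<Rightarrow> enat) \<Rightarrow> ('s \<times> bool) list set monoid" where
  "coxeter_group S M = presented_group S (coxeter_relators S M)"

definition coxeter_gen :: "'s set \<Rightarrow> ('s \<Rightarrow> 's \<Rightarrow> enat) \<Rightarrow> 's \<Rightarrow> ('s \<times> bool) list set" where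
  "coxeter_gen S M s = {w. pres_eq S (coxeter_relators S M) [(s, True)] w}"

definition coxeter_gens :: "'s set \<Rightarrow> ('s \<Rightarrow> 's \<Rightarrow> enat) \<Rightarrow> ('s \<times> bool) list set set" where
  "coxeter_gens S M = coxeter_gen S M ` S"


section \<open>Word length and Cayley graph\<close>

text \<open>
  In what follows X is a set of generators of the group G that is closed under inverses, as is
  the case for the generators of a Coxeter system, so words use letters from X only.
\<close>

definition word_length :: "('g, 'm) monoid_scheme \<Rightarrow> 'g set \<Rightarrow> 'g \<Rightarrow> nat" where
  "word_length G X w =
    (LEAST n. \<exists>xs \<in> lists X. length xs = n \<and> foldr (\<lambda>x y. x \<otimes>\<^bsub>G\<^esub> y) xs \<one>\<^bsub>G\<^esub> = w)"

definition cayley_adj :: "('g, 'm) monoid_scheme \<Rightarrow> 'g set \<Rightarrow> 'g \<Rightarrow> 'g \<Rightarrow> bool" where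
  "cayley_adj G X u v \<longleftrightarrow> (\<exists>s\<in>X. v = u \<otimes>\<^bsub>G\<^esub> s \<or> u = v \<otimes>\<^bsub>G\<^esub> s)"

definition cayley_path :: "('g, 'm) monoid_scheme \<Rightarrow> 'g set \<Rightarrow> 'g list \<Rightarrow> bool" where
  "cayley_path G X vs \<longleftrightarrow>
    vs \<noteq> [] \<and> vs \<in> lists (carrier G) \<and> successively (cayley_adj G X) vs"

definition geodesic :: "('g, 'm) monoid_scheme \<Rightarrow> 'g set \<Rightarrow> 'g list \<Rightarrow> bool" where
  "geodesic G X vs \<longleftrightarrow>
    cayley_path G X vs \<and>
    (\<forall>us. cayley_path G X us \<and> hd us = hd vs \<and> last us = last vs \<longrightarrow> length vs \<le> length us)"

definition weak_le :: "('g, 'm) monoid_scheme \<Rightarrow> 'g set \<Rightarrow> 'g \<Rightarrow> 'g \<Rightarrow> bool" where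
  "weak_le G X w v \<longleftrightarrow>
    (\<exists>vs. geodesic G X vs \<and> hd vs = \<one>\<^bsub>G\<^esub> \<and> last vs = v \<and> w \<in> set vs)"


section \<open>The compactification and smallness at infinity\<close>

definition inf_geodesic :: "('g, 'm) monoid_scheme \<Rightarrow> 'g set \<Rightarrow> (nat \<Rightarrow> 'g) \<Rightarrow> bool" where
  "inf_geodesic G X \<alpha> \<longleftrightarrow> (\<forall>n. geodesic G X (map \<alpha> [0..<Suc n]))"

definition weak_le_inf :: "('g, 'm) monoid_scheme \<Rightarrow> 'g set \<Rightarrow> 'g \<Rightarrow> (nat \<Rightarrow> 'g) \<Rightarrow> bool" where
  "weak_le_inf G X w \<alpha> \<longleftrightarrow> (\<forall>\<^sub>F i in sequentially. weak_le G X w (\<alpha> i))"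

definition geodesic_equiv ::
  "('g, 'm) monoid_scheme \<Rightarrow> 'g set \<Rightarrow> ((nat \<Rightarrow> 'g) \<times> (nat \<Rightarrow> 'g)) set" where
  "geodesic_equiv G X =
    {(\<alpha>, \<beta>). inf_geodesic G X \<alpha> \<and> inf_geodesic G X \<beta> \<and>
      (\<forall>w\<in>carrier G. weak_le_inf G X w \<alpha> \<longleftrightarrow> weak_le_inf G X w \<beta>)}"

definition boundary :: "('g, 'm) monoid_scheme \<Rightarrow> 'g set \<Rightarrow> (nat \<Rightarrow> 'g) set set" where
  "boundary G X = {\<alpha>. inf_geodesic G X \<alpha>} // geodesic_equiv G X"

definition compactification ::
  "('g, 'm) monoid_scheme \<Rightarrow> 'g set \<Rightarrow> ('g + (nat \<Rightarrow> 'g) set) set" where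
  "compactification G X = Inl ` carrier G \<union> Inr ` boundary G X"

fun below :: "('g, 'm) monoid_scheme \<Rightarrow> 'g set \<Rightarrow> 'g \<Rightarrow> 'g + (nat \<Rightarrow> 'g) set \<Rightarrow> bool" where
  "below G X w (Inl v) = weak_le G X w v"
| "below G X w (Inr z) = (\<forall>\<alpha>\<in>z. weak_le_inf G X w \<alpha>)"

definition compactification_topology ::
  "('g, 'm) monoid_scheme \<Rightarrow> 'g set \<Rightarrow> ('g + (nat \<Rightarrow> 'g) set) topology" where
  "compactification_topology G X = topology_generated_by
    ((\<lambda>w. {\<xi> \<in> compactification G X. below G X w \<xi>}) ` carrier G \<union>
     (\<lambda>w. {\<xi> \<in> compactification G X. \<not> below G X w \<xi>}) ` carrier G)"

definition small_at_infinity :: "('g, 'm) monoid_scheme \<Rightarrow> 'g set \<Rightarrow> bool" where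
  "small_at_infinity G X \<longleftrightarrow>
    (\<forall>x :: nat \<Rightarrow> 'g. \<forall>z \<in> boundary G X.
      (\<forall>i. x i \<in> carrier G) \<and>
      limitin (compactification_topology G X) (\<lambda>i. Inl (x i)) (Inr z) sequentially \<longrightarrow>
      (\<forall>w \<in> carrier G.
        limitin (compactification_topology G X) (\<lambda>i. Inl (x i \<otimes>\<^bsub>G\<^esub> w)) (Inr z) sequentially))"


section \<open>Operators on $\ell_2$ and Schatten classes\<close>

text \<open>
  Vectors of the Hilbert space $\ell_2(A)$ are functions that vanish outside A; operators are
  functions of which only the values on these vectors matter.
\<close>

definition ell2 :: "'a set \<Rightarrow> ('a \<Rightarrow> complex) set" where
  "ell2 A = {f. (\<forall>x. x \<notin> A \<longrightarrow> f x = 0) \<and> (\<lambda>x. (cmod (f x))\<^sup>2) summable_on A}"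

definition ell2_norm :: "'a set \<Rightarrow> ('a \<Rightarrow> complex) \<Rightarrow> real" where
  "ell2_norm A f = sqrt (\<Sum>\<^sub>\<infinity>x\<in>A. (cmod (f x))\<^sup>2)"

definition ell2_inner :: "'a set \<Rightarrow> ('a \<Rightarrow> complex) \<Rightarrow> ('a \<Rightarrow> complex) \<Rightarrow> complex" where
  "ell2_inner A f g = (\<Sum>\<^sub>\<infinity>x\<in>A. f x * cnj (g x))"

definition fscale :: "complex \<Rightarrow> ('a \<Rightarrow> complex) \<Rightarrow> 'a \<Rightarrow> complex" where
  "fscale c f = (\<lambda>x. c * f x)"

lemma vector_space_fscale: "vector_space fscale"
  by unfold_locales (auto simp: fscale_def algebra_simps fun_eq_iff)

definition bounded_ops :: "'a set \<Rightarrow> (('a \<Rightarrow> complex) \<Rightarrow> 'a \<Rightarrow> complex) set" where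
  "bounded_ops A =
    {T. (\<forall>f\<in>ell2 A. T f \<in> ell2 A) \<and>
        (\<forall>f\<in>ell2 A. \<forall>g\<in>ell2 A. T (f + g) = T f + T g) \<and>
        (\<forall>c. \<forall>f\<in>ell2 A. T (fscale c f) = fscale c (T f)) \<and>
        (\<exists>C. \<forall>f\<in>ell2 A. ell2_norm A (T f) \<le> C * ell2_norm A f)}"

definition compact_ops :: "'a set \<Rightarrow> (('a \<Rightarrow> complex) \<Rightarrow> 'a \<Rightarrow> complex) set" where
  "compact_ops A =
    {T \<in> bounded_ops A.
      \<forall>f :: nat \<Rightarrow> 'a \<Rightarrow> complex.
        (\<forall>n. f n \<in> ell2 A) \<and> (\<exists>B. \<forall>n. ell2_norm A (f n) \<le> B) \<longrightarrow>
        (\<exists>g\<in>ell2 A. \<exists>r. strict_mono r \<and> (\<lambda>n. ell2_norm A (T (f (r n)) - g)) \<longlonglongrightarrow> 0)}"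

text \<open>
  For $s > 0$, the multiplicity of s as a singular value of T is the dimension of the eigenspace
  $\ker(T^* T - s^2)$; the eigenvalue equation is tested against all vectors u.
\<close>

definition singular_space ::
  "'a set \<Rightarrow> (('a \<Rightarrow> complex) \<Rightarrow> 'a \<Rightarrow> complex) \<Rightarrow> real \<Rightarrow> ('a \<Rightarrow> complex) set" where
  "singular_space A T s =
    {v \<in> ell2 A. \<forall>u\<in>ell2 A. ell2_inner A (T v) (T u) = of_real (s\<^sup>2) * ell2_inner A v u}"

definition singular_mult ::
  "'a set \<Rightarrow> (('a \<Rightarrow> complex) \<Rightarrow> 'a \<Rightarrow> complex) \<Rightarrow> real \<Rightarrow> nat" where
  "singular_mult A T s = vector_space.dim fscale (singular_space A T s)"

text \<open>
  The Schatten class for $p < \infty$: compact operators whose singular values, counted with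
  multiplicity, are p-summable.  Compactness makes the multiplicities of $s > 0$ finite, so the
  convention that infinite dimensions are 0 does no harm.
\<close>

definition schatten_class ::
  "ereal \<Rightarrow> 'a set \<Rightarrow> (('a \<Rightarrow> complex) \<Rightarrow> 'a \<Rightarrow> complex) set" where
  "schatten_class p A =
    (if p = \<infinity> then compact_ops A
     else {T \<in> compact_ops A.
       (\<lambda>s. real (singular_mult A T s) * s powr real_of_ereal p) summable_on {0<..}})"


section \<open>The gradient-Schatten property\<close>

text \<open>
  The element $\sum_w f(w) \lambda_w$ of the group algebra is represented by the finitely
  supported function f.  Then \<open>conv G f g\<close> is both the product of the group algebra and, for g in
  $\ell_2$, the action of f on g in the left regular representation.
\<close>

definition group_algebra :: "('g, 'm) monoid_scheme \<Rightarrow> ('g \<Rightarrow> complex) set" where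
  "group_algebra G = {f. finite {x. f x \<noteq> 0} \<and> {x. f x \<noteq> 0} \<subseteq> carrier G}"

definition conv ::
  "('g, 'm) monoid_scheme \<Rightarrow> ('g \<Rightarrow> complex) \<Rightarrow> ('g \<Rightarrow> complex) \<Rightarrow> 'g \<Rightarrow> complex" where
  "conv G f g = (\<lambda>x. if x \<in> carrier G
     then \<Sum>y | f y \<noteq> 0. f y * g (inv\<^bsub>G\<^esub> y \<otimes>\<^bsub>G\<^esub> x) else 0)"

definition delta :: "'g \<Rightarrow> 'g \<Rightarrow> complex" where
  "delta w = (\<lambda>x. if x = w then 1 else 0)"

text \<open>
  The generator of the semigroup $\Phi_t(\lambda_w) = e^{-t \psi(w)} \lambda_w$ on the group
  algebra.
\<close>

definition qms_generator :: "('g \<Rightarrow> nat) \<Rightarrow> ('g \<Rightarrow> complex) \<Rightarrow> 'g \<Rightarrow> complex" where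
  "qms_generator \<psi> f = (\<lambda>w. of_nat (\<psi> w) * f w)"

definition gradient_map ::
  "('g, 'm) monoid_scheme \<Rightarrow> ('g \<Rightarrow> nat) \<Rightarrow>
    ('g \<Rightarrow> complex) \<Rightarrow> ('g \<Rightarrow> complex) \<Rightarrow> ('g \<Rightarrow> complex) \<Rightarrow> 'g \<Rightarrow> complex" where
  "gradient_map G \<psi> a b x =
    qms_generator \<psi> (conv G (conv G a x) b) + conv G (conv G a (qms_generator \<psi> x)) b
    - conv G (qms_generator \<psi> (conv G a x)) b - conv G a (qms_generator \<psi> (conv G x b))"

text \<open>The semigroup associated with the length function \<open>\<psi>\<close> on G is gradient-$\mathcal{S}_p$.\<close>

definition gradient_schatten ::
  "ereal \<Rightarrow> ('g, 'm) monoid_scheme \<Rightarrow> ('g \<Rightarrow> nat) \<Rightarrow> bool" where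
  "gradient_schatten p G \<psi> \<longleftrightarrow>
    (\<forall>a\<in>group_algebra G. \<forall>b\<in>group_algebra G.
      \<exists>T\<in>schatten_class p (carrier G). \<forall>x\<in>group_algebra G.
        T (conv G x (delta \<one>\<^bsub>G\<^esub>)) = conv G (gradient_map G \<psi> a b x) (delta \<one>\<^bsub>G\<^esub>))"

end

theory Submission
  imports Defs
begin

text \<open>
  Write $c_{u,v}(w) = |uwv| + |w| - |uw| - |wv|$. The map $\Psi^{a,b}$ for $a = \lambda_u$,
  $b = \lambda_v$ sends $\lambda_w$ to $c_{u,v}(w) \lambda_{uwv}$, a weighted translation with integer
  weights. It is compact only if $c_{u,v}$ has finite support, and then it has finite rank, so
  that (1) says the same for every p. By the cocycle rules for c in u and v it suffices to take u
  and v in S, and the exchange condition shows that $c_{t,s}(w) \neq 0$ iff $ws = tw$: this is (2).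

  If all $c_{u,v}$ have finite support, then for fixed g and v almost all x satisfy
  $g \le x \Leftrightarrow g \le xv$, which gives (3). Conversely, suppose that infinitely many w satisfy
  $ws = tw$ for some s. Each w with $ws = tw > w$ and $w \neq e$ factors, with additive lengths, as
  $w = w'u$ with $w'q = tw' > w'$ for a generator q and u from a finite set of alternating words.
  By Koenig's lemma some geodesic ray passes through infinitely many such elements; none of them is
  above t, but each becomes so after multiplication by a suitable generator on the right.
\<close>

section \<open>Groups given by presentations\<close>

text \<open>A presentation gives no direct access to lengths; not even the exact orders of the
  products s t can be read off. What it does give are two invariants modulo 2 of a word: its number
  of letters, and the number of times a fixed element occurs among its reflections. Both survive
  cancellations and relators, and together they yield \<open>parity\<close> and
  \<open>exchange\<close>, after which the presentation is not consulted again. From (3) to (2) the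
  obstacle is to reach the boundary with intertwiners. Koenig's lemma applied to geodesics towards
  infinitely many of them gives a ray through their prefixes, about which nothing is known. Hence
  the tree branches by whole factors u instead of letters: cutting off u leaves an intertwiner
  again, with another generator q but the same t. Keeping t fixed is what matters, since t is the
  element tested with the weak order; the changing q is harmless because there are finitely many
  generators.\<close>

declare foldr_append [simp del] in_lists_conv_set [simp del] in_listsI [rule del] in_listsD [rule del]

lemma pres_eq_words:
  "pres_eq S R u v \<Longrightarrow> u \<in> lists (S \<times> UNIV) \<and> v \<in> lists (S \<times> UNIV)"
  by (induction rule: pres_eq.induct) auto

lemma rev_in_lists [simp]: "rev xs \<in> lists A \<longleftrightarrow> xs \<in> lists A"
  by (simp add: in_lists_conv_set)

lemma pres_eq_append_left:
  assumes "pres_eq S R u v" "w \<in> lists (S \<times> UNIV)"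
  shows "pres_eq S R (w @ u) (w @ v)"
  using assms(1)
proof (induction rule: pres_eq.induct)
  case (cancel u v a b)
  then show ?case using pres_eq.cancel[of "w @ u" S v a R b] assms(2) by simp
next
  case (relator u v r)
  then show ?case using pres_eq.relator[of "w @ u" S v r R] assms(2) by simp
next
  case (refl u)
  then show ?case using assms(2) by (simp add: pres_eq.refl)
qed (blast intro: pres_eq.sym pres_eq.trans)+

lemma pres_eq_append_right:
  assumes "pres_eq S R u v" "w \<in> lists (S \<times> UNIV)"
  shows "pres_eq S R (u @ w) (v @ w)"
  using assms(1)
proof (induction rule: pres_eq.induct)
  case (cancel u v a b)
  then show ?case using pres_eq.cancel[of u S "v @ w" a R b] assms(2) by simp
next
  case (relator u v r)
  then show ?case using pres_eq.relator[of u S "v @ w" r R] assms(2) by simp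
next
  case (refl u)
  then show ?case using assms(2) by (simp add: pres_eq.refl)
qed (blast intro: pres_eq.sym pres_eq.trans)+

lemma pres_eq_append:
  assumes "pres_eq S R u u'" "pres_eq S R v v'"
  shows "pres_eq S R (u @ v) (u' @ v')"
  using pres_eq_append_right[OF assms(1)] pres_eq_append_left[OF assms(2)] pres_eq_words[OF assms(1)]
    pres_eq_words[OF assms(2)] by (blast intro: pres_eq.trans)

definition pres_class ::
  "'s set \<Rightarrow> ('s \<times> bool) list set \<Rightarrow> ('s \<times> bool) list \<Rightarrow> ('s \<times> bool) list set" where
  "pres_class S R u = {w. pres_eq S R u w}"

lemma pres_class_eq_iff:
  "u \<in> lists (S \<times> UNIV) \<Longrightarrow> pres_class S R u = pres_class S R v \<longleftrightarrow> pres_eq S R u v"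
  unfolding pres_class_def by (blast intro: pres_eq.refl pres_eq.sym pres_eq.trans)

lemma carrier_presented_group:
  "carrier (presented_group S R) = pres_class S R ` lists (S \<times> UNIV)"
  by (auto simp: presented_group_def pres_class_def quotient_def)

lemma one_presented_group: "\<one>\<^bsub>presented_group S R\<^esub> = pres_class S R []"
  by (simp add: presented_group_def pres_class_def)

lemma mult_presented_group:
  assumes "u \<in> lists (S \<times> UNIV)" "v \<in> lists (S \<times> UNIV)"
  shows "pres_class S R u \<otimes>\<^bsub>presented_group S R\<^esub> pres_class S R v = pres_class S R (u @ v)"
proof -
  have "(\<exists>u'. pres_eq S R u u' \<and> (\<exists>v'. pres_eq S R v v' \<and> pres_eq S R (u' @ v') w))
      \<longleftrightarrow> pres_eq S R (u @ v) w" for w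
    using assms by (blast intro: pres_eq.refl pres_eq.sym pres_eq.trans pres_eq_append)
  then show ?thesis by (simp add: presented_group_def pres_class_def Bex_def)
qed

lemma pres_eq_inverse:
  assumes "u \<in> lists (S \<times> UNIV)"
  shows "pres_eq S R (map (\<lambda>(a, b). (a, \<not> b)) (rev u) @ u) []"
  using assms
proof (induction u)
  case Nil
  then show ?case by (auto intro: pres_eq.refl)
next
  case (Cons x u)
  obtain a b where x: "x = (a, b)" by force
  let ?i = "map (\<lambda>(a, b). (a, \<not> b)) (rev u)"
  have i: "?i \<in> lists (S \<times> UNIV)" using Cons by (auto simp: in_lists_conv_set)
  have "pres_eq S R (?i @ [(a, \<not> b), (a, \<not> \<not> b)] @ u) (?i @ u)"
    by (rule pres_eq.cancel) (use i Cons x in auto)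
  then show ?case using Cons x by (auto intro: pres_eq.trans)
qed

lemma group_presented_group: "group (presented_group S R)"
proof (rule groupI)
  let ?G = "presented_group S R"
  have car: "\<exists>u \<in> lists (S \<times> UNIV). x = pres_class S R u" if "x \<in> carrier ?G" for x
    using that by (auto simp: carrier_presented_group)
  show "x \<otimes>\<^bsub>?G\<^esub> y \<in> carrier ?G" if "x \<in> carrier ?G" "y \<in> carrier ?G" for x y
    using that by (auto simp: carrier_presented_group mult_presented_group)
  show "\<one>\<^bsub>?G\<^esub> \<in> carrier ?G"
    by (auto simp: carrier_presented_group one_presented_group)
  show "x \<otimes>\<^bsub>?G\<^esub> y \<otimes>\<^bsub>?G\<^esub> z = x \<otimes>\<^bsub>?G\<^esub> (y \<otimes>\<^bsub>?G\<^esub> z)"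
    if "x \<in> carrier ?G" "y \<in> carrier ?G" "z \<in> carrier ?G" for x y z
    using that[THEN car] by (auto simp: mult_presented_group)
  show "\<one>\<^bsub>?G\<^esub> \<otimes>\<^bsub>?G\<^esub> x = x" if "x \<in> carrier ?G" for x
    using that[THEN car] by (auto simp: mult_presented_group one_presented_group)
  show "\<exists>y\<in>carrier ?G. y \<otimes>\<^bsub>?G\<^esub> x = \<one>\<^bsub>?G\<^esub>" if x: "x \<in> carrier ?G" for x
  proof -
    obtain u where u: "u \<in> lists (S \<times> UNIV)" "x = pres_class S R u" using car[OF x] by blast
    let ?i = "map (\<lambda>(a, b). (a, \<not> b)) (rev u)"
    have i: "?i \<in> lists (S \<times> UNIV)" using u by (auto simp: in_lists_conv_set)
    have "pres_class S R ?i \<otimes>\<^bsub>?G\<^esub> x = \<one>\<^bsub>?G\<^esub>"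
      using u i pres_eq_inverse[OF u(1), of R]
      by (simp add: mult_presented_group one_presented_group pres_class_eq_iff)
    then show ?thesis using i by (auto simp: carrier_presented_group)
  qed
qed

text \<open>
  \<open>refl_count G [x\<^sub>1, \<dots>, x\<^sub>n] r\<close> counts the indices i with
  $r = x_1 \cdots x_{i-1} x_i x_{i-1} \cdots x_1$.
\<close>

fun refl_count :: "('g, 'm) monoid_scheme \<Rightarrow> 'g list \<Rightarrow> 'g \<Rightarrow> nat" where
  "refl_count G [] r = 0"
| "refl_count G (x # xs) r = (if r = x then 1 else 0) + refl_count G xs (x \<otimes>\<^bsub>G\<^esub> r \<otimes>\<^bsub>G\<^esub> x)"

abbreviation prd :: "('g, 'm) monoid_scheme \<Rightarrow> 'g list \<Rightarrow> 'g" where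
  "prd G xs \<equiv> foldr (\<lambda>x y. x \<otimes>\<^bsub>G\<^esub> y) xs \<one>\<^bsub>G\<^esub>"

text \<open>Everything about lengths, the Cayley graph and the boundary that needs no Coxeter
  relations lives at this generality. Since generators are involutions, words in \<open>X\<close>
  need no inverse letters, and reversing a word inverts its product.\<close>

locale involution_generated = group G for G :: "('g, 'm) monoid_scheme" (structure) +
  fixes X :: "'g set"
  assumes gens_carrier: "X \<subseteq> carrier G"
    and gens_involution: "x \<in> X \<Longrightarrow> x \<otimes> x = \<one>"
    and gens_generate: "g \<in> carrier G \<Longrightarrow> \<exists>xs \<in> lists X. prd G xs = g"
begin

abbreviation len :: "'g \<Rightarrow> nat" where "len \<equiv> word_length G X"

lemma gen_closed [simp]: "x \<in> X \<Longrightarrow> x \<in> carrier G"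
  using gens_carrier by auto

lemma lists_carrier: "xs \<in> lists X \<Longrightarrow> xs \<in> lists (carrier G)"
  using gens_carrier lists_mono by blast

lemma inv_gen [simp]: "x \<in> X \<Longrightarrow> inv x = x"
  by (metis gens_involution gen_closed inv_equality)

lemma gen_gen_cancel [simp]: "x \<in> X \<Longrightarrow> g \<in> carrier G \<Longrightarrow> x \<otimes> (x \<otimes> g) = g"
  by (metis gens_involution gen_closed l_one m_assoc)

lemma prd_closed_carrier [simp]: "xs \<in> lists (carrier G) \<Longrightarrow> prd G xs \<in> carrier G"
  by (induction xs) auto

lemma prd_closed [simp]: "xs \<in> lists X \<Longrightarrow> prd G xs \<in> carrier G"
  using lists_carrier prd_closed_carrier by blast

lemma prd_append:
  "xs \<in> lists X \<Longrightarrow> ys \<in> lists X \<Longrightarrow> prd G (xs @ ys) = prd G xs \<otimes> prd G ys"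
  by (induction xs) (auto simp: m_assoc)

lemma prd_rev: "xs \<in> lists X \<Longrightarrow> prd G (rev xs) = inv (prd G xs)"
  by (induction xs) (auto simp: prd_append inv_mult_group)

text \<open>The reflections contributed by \<open>ys\<close> get conjugated by
  \<open>prd G xs\<close> when \<open>xs\<close> is put in front. Hence inserting a subword of
  product one changes no later reflection, and only the count inside the subword has to be
  examined.\<close>

lemma refl_count_append:
  "xs \<in> lists X \<Longrightarrow> ys \<in> lists X \<Longrightarrow> r \<in> carrier G \<Longrightarrow>
    refl_count G (xs @ ys) r = refl_count G xs r + refl_count G ys (inv (prd G xs) \<otimes> r \<otimes> prd G xs)"
proof (induction xs arbitrary: r)
  case (Cons x xs)
  from Cons.prems have x: "x \<in> X" "xs \<in> lists X" by simp_all
  with Cons.prems have "inv (prd G xs) \<otimes> (x \<otimes> r \<otimes> x) \<otimes> prd G xs = inv (x \<otimes> prd G xs) \<otimes> r \<otimes> (x \<otimes> prd G xs)"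
    by (auto simp: inv_mult_group m_assoc)
  then show ?case using Cons by (auto)
qed auto

text \<open>If \<open>r\<close> is x_1 ... x_(i-1) x_i x_(i-1) ... x_1, then left multiplication by
  \<open>r\<close> cancels the first i letters of the word and puts back the first i - 1, so that
  just the letter x_i is lost.\<close>

lemma refl_count_pos_delete:
  assumes "xs \<in> lists X" "r \<in> carrier G" "refl_count G xs r > 0"
  shows "\<exists>i<length xs. r \<otimes> prd G xs = prd G (take i xs @ drop (Suc i) xs)"
  using assms
proof (induction xs arbitrary: r rule: list.induct)
  case (Cons x xs)
  have x: "x \<in> X" "xs \<in> lists X" "prd G xs \<in> carrier G" using Cons(2) by auto
  show ?case
  proof (cases "r = x")
    case True
    then show ?thesis using x by (intro exI[of _ 0]) simp
  next
    case False
    then have "refl_count G xs (x \<otimes> r \<otimes> x) > 0" using Cons(4) by simp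
    then obtain i where i: "i < length xs"
      "(x \<otimes> r \<otimes> x) \<otimes> prd G xs = prd G (take i xs @ drop (Suc i) xs)"
      using Cons(1)[of "x \<otimes> r \<otimes> x"] x Cons(3) by auto
    have "r \<otimes> (x \<otimes> prd G xs) = x \<otimes> ((x \<otimes> r \<otimes> x) \<otimes> prd G xs)"
      using x Cons(3) by (simp add: m_assoc)
    then show ?thesis using i by (intro exI[of _ "Suc i"]) auto
  qed
qed auto

lemma len_le: "xs \<in> lists X \<Longrightarrow> len (prd G xs) \<le> length xs"
  unfolding word_length_def by (rule Least_le) auto

lemma len_le': "xs \<in> lists X \<Longrightarrow> prd G xs = g \<Longrightarrow> len g \<le> length xs"
  using len_le by blast

lemma reduced_word:
  assumes "g \<in> carrier G"
  obtains xs where "xs \<in> lists X" "prd G xs = g" "length xs = len g"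
proof -
  have "\<exists>n. \<exists>xs \<in> lists X. length xs = n \<and> prd G xs = g" using gens_generate[OF assms] by blast
  then have "\<exists>xs \<in> lists X. length xs = len g \<and> prd G xs = g"
    unfolding word_length_def by (rule LeastI_ex)
  then show ?thesis using that by blast
qed

lemma len_mult:
  assumes "g \<in> carrier G" "h \<in> carrier G"
  shows "len (g \<otimes> h) \<le> len g + len h"
proof -
  obtain xs ys where "xs \<in> lists X" "prd G xs = g" "length xs = len g"
    "ys \<in> lists X" "prd G ys = h" "length ys = len h"
    using reduced_word[OF assms(1)] reduced_word[OF assms(2)] by metis
  then show ?thesis using len_le[of "xs @ ys"] by (auto simp: prd_append)
qed

lemma len_one [simp]: "len \<one> = 0"
  using len_le[of "[]"] by simp

lemma len_inv_le: "g \<in> carrier G \<Longrightarrow> len (inv g) \<le> len g"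
  by (metis len_le' length_rev rev_in_lists prd_rev reduced_word)

lemma len_inv [simp]: "g \<in> carrier G \<Longrightarrow> len (inv g) = len g"
  using len_inv_le[of g] len_inv_le[of "inv g"] by simp

lemma len_gen_le: "s \<in> X \<Longrightarrow> len s \<le> 1"
  using len_le[of "[s]"] by simp

end

section \<open>The exchange condition\<close>

context involution_generated
begin

lemma conj_gen_eq_iff:
  assumes "x \<in> X" "p \<in> carrier G" "q \<in> carrier G"
  shows "x \<otimes> p \<otimes> x = q \<longleftrightarrow> p = x \<otimes> q \<otimes> x"
  using assms gens_involution[OF assms(1)] by (auto simp: m_assoc)

text \<open>The letter at position i (from 0) of s t s t ... contributes the dihedral reflection (s
  t)^i s. Stripping one pair s t conjugates \<open>r\<close> by \<open>s\<close> and then by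
  \<open>t\<close>, which shifts i by two.\<close>

lemma refl_count_alternating:
  assumes "s \<in> X" "t \<in> X" "r \<in> carrier G"
  shows "refl_count G (concat (replicate n [s, t])) r =
    (\<Sum>i<2 * n. if (s \<otimes> t) [^] i \<otimes> s = r then 1 else 0)"
  using assms(3)
proof (induction n arbitrary: r)
  case (Suc n)
  have [simp]: "s \<in> carrier G" "t \<in> carrier G" using assms by auto
  have step: "(s \<otimes> t) [^] Suc (Suc i) \<otimes> s = r \<longleftrightarrow>
      (s \<otimes> t) [^] i \<otimes> s = t \<otimes> (s \<otimes> r \<otimes> s) \<otimes> t" for i
  proof -
    have "(s \<otimes> t) [^] Suc (Suc i) = s \<otimes> t \<otimes> ((s \<otimes> t) [^] i \<otimes> (s \<otimes> t))"
      using nat_pow_Suc2[of "s \<otimes> t" i] by (simp add: m_assoc)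
    then have "(s \<otimes> t) [^] Suc (Suc i) \<otimes> s = s \<otimes> (t \<otimes> ((s \<otimes> t) [^] i \<otimes> s) \<otimes> t) \<otimes> s"
      by (simp add: m_assoc)
    then show ?thesis
      using assms Suc.prems by (simp add: conj_gen_eq_iff)
  qed
  have one: "(s \<otimes> t) [^] Suc 0 \<otimes> s = r \<longleftrightarrow> s \<otimes> r \<otimes> s = t"
    using assms Suc.prems conj_gen_eq_iff[of s t r] by auto
  have shift: "(\<Sum>i<2 * Suc n. f i) = f 0 + f (Suc 0) + (\<Sum>i<2 * n. f (Suc (Suc i)))"
    for f :: "nat \<Rightarrow> nat"
    by (simp add: sum.lessThan_Suc_shift del: sum.lessThan_Suc)
  have "refl_count G (concat (replicate (Suc n) [s, t])) r =
      (if r = s then 1 else 0) + (if s \<otimes> r \<otimes> s = t then 1 else 0) +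
      (\<Sum>i<2 * n. if (s \<otimes> t) [^] i \<otimes> s = t \<otimes> (s \<otimes> r \<otimes> s) \<otimes> t then 1 else 0)"
    using Suc.IH[of "t \<otimes> (s \<otimes> r \<otimes> s) \<otimes> t"] Suc.prems by simp
  then show ?case
    unfolding shift step one by (simp add: eq_commute)
qed simp

lemma prd_alternating:
  "s \<in> X \<Longrightarrow> t \<in> X \<Longrightarrow> prd G (concat (replicate n [s, t])) = (s \<otimes> t) [^] n"
proof (induction n)
  case (Suc n)
  then have "(s \<otimes> t) [^] Suc n = (s \<otimes> t) \<otimes> (s \<otimes> t) [^] n"
    by (intro nat_pow_Suc2) auto
  then show ?case using Suc by (simp add: m_assoc)
qed simp

text \<open>When (s t)^n = 1, the 2n reflections (s t)^i s run twice through the same list of n, so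
  each element is counted an even number of times. Any such n will do; the order of s t, still
  unknown, does not enter.\<close>

lemma even_refl_count_relator:
  assumes "s \<in> X" "t \<in> X" "r \<in> carrier G" "(s \<otimes> t) [^] n = \<one>"
  shows "even (refl_count G (concat (replicate n [s, t])) r)"
proof -
  let ?f = "\<lambda>i::nat. if (s \<otimes> t) [^] i \<otimes> s = r then 1 else 0 :: nat"
  have split: "(\<Sum>i<n + k. ?f i) = (\<Sum>i<n. ?f i) + (\<Sum>i<k. ?f (n + i))" for k
    by (induction k) auto
  have "(s \<otimes> t) [^] (n + i) = (s \<otimes> t) [^] i" for i
    using assms nat_pow_mult[of "s \<otimes> t" n i] by (metis gen_closed l_one m_closed nat_pow_closed)
  then have "(\<Sum>i<2 * n. ?f i) = 2 * (\<Sum>i<n. ?f i)"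
    using split[of n] by (simp add: mult_2)
  then show ?thesis using assms by (simp add: refl_count_alternating)
qed

end

text \<open>These are the facts that later arguments take from the Coxeter presentation.
  \<open>parity\<close> supplies what \<open>exchange\<close> does not say: a generator never
  preserves the length.\<close>

locale exchange_group = involution_generated G X
  for G :: "('g, 'm) monoid_scheme" (structure) and X :: "'g set" +
  assumes finite_gens: "finite X"
    and parity: "xs \<in> lists X \<Longrightarrow> ys \<in> lists X \<Longrightarrow> prd G xs = prd G ys \<Longrightarrow>
      even (length xs) = even (length ys)"
    and exchange: "xs \<in> lists X \<Longrightarrow> s \<in> X \<Longrightarrow>
      word_length G X (s \<otimes> prd G xs) < word_length G X (prd G xs) \<Longrightarrow>
      \<exists>i<length xs. s \<otimes> prd G xs = prd G (take i xs @ drop (Suc i) xs)"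

section \<open>The Coxeter presentation implies the exchange condition\<close>

context
  fixes S :: "'s set" and M :: "'s \<Rightarrow> 's \<Rightarrow> enat"
  assumes M: "coxeter_matrix S M"
begin

private abbreviation (input) "R \<equiv> coxeter_relators S M"
private abbreviation (input) "W \<equiv> coxeter_group S M"
private abbreviation (input) "gen \<equiv> coxeter_gen S M"
private abbreviation (input) "gens u \<equiv> map (\<lambda>x :: 's \<times> bool. gen (fst x)) u"

lemma coxeter_gen_eq: "gen s = pres_class S R [(s, True)]"
  by (simp add: coxeter_gen_def pres_class_def)

lemma pres_eq_double_letter:
  assumes "a \<in> S" "v \<in> lists (S \<times> UNIV)"
  shows "pres_eq S R ((a, True) # (a, True) # v) v"
proof -
  have "M a a = enat 1" using M assms by (simp add: coxeter_matrix_def one_enat_def)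
  then have "concat (replicate 1 [(a, True), (a, True)]) \<in> R"
    using assms unfolding coxeter_relators_def by blast
  then have "[(a, True), (a, True)] \<in> R" by simp
  from pres_eq.relator[of "[]" S v, OF _ _ this] show ?thesis using assms by simp
qed

text \<open>Generators are involutions, so a letter and its formal inverse have the same class;
  hence \<open>gens\<close> may forget the flags.\<close>

lemma pres_class_letter:
  assumes "a \<in> S"
  shows "pres_class S R [(a, b)] = gen a"
proof (cases b)
  case False
  have "pres_eq S R ([(a, True)] @ [(a, True), (a, \<not> True)] @ []) ([(a, True)] @ [])"
    by (rule pres_eq.cancel) (use assms in auto)
  moreover have "pres_eq S R ((a, True) # (a, True) # [(a, False)]) [(a, False)]"
    by (rule pres_eq_double_letter) (use assms in auto)
  ultimately have "pres_eq S R [(a, False)] [(a, True)]"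
    by (auto intro: pres_eq.sym pres_eq.trans)
  then show ?thesis using False assms by (simp add: coxeter_gen_eq pres_class_eq_iff)
qed (simp add: coxeter_gen_eq)

lemma pres_class_prd:
  "u \<in> lists (S \<times> UNIV) \<Longrightarrow> pres_class S R u = prd W (gens u)"
proof (induction u)
  case Nil
  then show ?case by (simp add: coxeter_group_def one_presented_group)
next
  case (Cons x u)
  have "pres_class S R (x # u) = pres_class S R [x] \<otimes>\<^bsub>W\<^esub> pres_class S R u"
    using Cons.prems mult_presented_group[of "[x]" S u R] by (simp add: coxeter_group_def)
  moreover have "pres_class S R [x] = gen (fst x)"
    using Cons.prems pres_class_letter[of "fst x" "snd x"] by auto
  ultimately show ?case using Cons by simp
qed

lemma involution_generated_coxeter: "involution_generated W (coxeter_gens S M)"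
proof -
  interpret group W unfolding coxeter_group_def by (rule group_presented_group)
  show ?thesis
  proof
    show "coxeter_gens S M \<subseteq> carrier W"
      by (auto simp: coxeter_gens_def coxeter_gen_eq coxeter_group_def carrier_presented_group)
    show "x \<otimes>\<^bsub>W\<^esub> x = \<one>\<^bsub>W\<^esub>" if "x \<in> coxeter_gens S M" for x
    proof -
      obtain a where a: "a \<in> S" "x = pres_class S R [(a, True)]"
        using \<open>x \<in> coxeter_gens S M\<close> by (auto simp: coxeter_gens_def coxeter_gen_eq)
      then have "pres_class S R [(a, True), (a, True)] = pres_class S R []"
        using pres_eq_double_letter[of a "[]"] by (simp add: pres_class_eq_iff)
      then show ?thesis
        using a by (simp add: coxeter_group_def mult_presented_group one_presented_group)
    qed
    show "\<exists>xs\<in>lists (coxeter_gens S M). prd W xs = g" if "g \<in> carrier W" for g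
    proof -
      obtain u where u: "u \<in> lists (S \<times> UNIV)" "g = pres_class S R u"
        using \<open>g \<in> carrier W\<close> by (auto simp: coxeter_group_def carrier_presented_group)
      then have "gens u \<in> lists (coxeter_gens S M)"
        by (auto simp: in_lists_conv_set coxeter_gens_def)
      then show ?thesis using u pres_class_prd by metis
    qed
  qed
qed

interpretation W: involution_generated W "coxeter_gens S M"
  by (rule involution_generated_coxeter)

text \<open>This leads back from lists of group elements to words over \<open>S\<close>, where the
  invariants of \<open>pres_eq\<close> are available. The lift is a choice, as \<open>gen\<close> is
  not known to be injective.\<close>

lemma coxeter_word_lift:
  assumes "xs \<in> lists (coxeter_gens S M)"
  obtains u where "u \<in> lists (S \<times> UNIV)" "xs = gens u"
proof -
  have "\<exists>u \<in> lists (S \<times> UNIV). xs = gens u"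
    using assms
  proof (induction xs)
    case (Cons x xs)
    then obtain u where "u \<in> lists (S \<times> UNIV)" "xs = gens u" by blast
    moreover obtain s where "s \<in> S" "x = gen s" using Cons.hyps by (auto simp: coxeter_gens_def)
    ultimately show ?case by (intro bexI[of _ "(s, True) # u"]) auto
  qed simp
  then show ?thesis using that by blast
qed

lemma gen_in_gens [simp]: "s \<in> S \<Longrightarrow> gen s \<in> coxeter_gens S M"
  by (simp add: coxeter_gens_def)

lemma word_in_gens: "u \<in> lists (S \<times> UNIV) \<Longrightarrow> gens u \<in> lists (coxeter_gens S M)"
  by (auto simp: in_lists_conv_set coxeter_gens_def)

text \<open>This is the sign character: cancellations and relators remove an even number of
  letters.\<close>

lemma even_length_cong: "pres_eq S R u v \<Longrightarrow> even (length u) = even (length v)"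
proof (induction rule: pres_eq.induct)
  case (relator u v r)
  then obtain s t k where "r = concat (replicate k [(s, True), (t, True)])"
    by (auto simp: coxeter_relators_def)
  then have "length r = k * 2" by (simp add: length_concat sum_list_replicate)
  then show ?case by simp
qed auto

text \<open>The removed subword, a pair a a or a relator, has product one, so by
  \<open>refl_count_append\<close> only its own reflections matter. For a a these are
  \<open>a\<close> twice, and for a relator \<open>even_refl_count_relator\<close> applies. Thus the
  parity depends on the group element alone.\<close>

lemma even_refl_count_cong:
  assumes "pres_eq S R u v" "r \<in> carrier W"
  shows "even (refl_count W (gens u) r) = even (refl_count W (gens v) r)"
  using assms
proof (induction arbitrary: r rule: pres_eq.induct)
  case (cancel u v a b)
  have drop2: "even (refl_count W (gen a # gen a # gens v) x) = even (refl_count W (gens v) x)"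
    if "x \<in> carrier W" for x
  proof -
    have [simp]: "gen a \<in> coxeter_gens S M" using cancel by simp
    have "gen a \<otimes>\<^bsub>W\<^esub> x \<otimes>\<^bsub>W\<^esub> gen a = gen a \<longleftrightarrow> x = gen a"
      using W.conj_gen_eq_iff[of "gen a" x "gen a"] W.gens_involution[of "gen a"] that by auto
    moreover have "gen a \<otimes>\<^bsub>W\<^esub> (gen a \<otimes>\<^bsub>W\<^esub> x \<otimes>\<^bsub>W\<^esub> gen a) \<otimes>\<^bsub>W\<^esub> gen a = x"
      using W.gens_involution[of "gen a"] that by (simp add: W.m_assoc)
    ultimately show ?thesis by auto
  qed
  have "gen a # gen a # gens v \<in> lists (coxeter_gens S M)" using cancel by (simp add: word_in_gens)
  then have "even (refl_count W (gens u @ gen a # gen a # gens v) r) =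
      even (refl_count W (gens u @ gens v) r)"
    using cancel word_in_gens drop2 by (simp only: W.refl_count_append even_add) simp
  then show ?case by simp
next
  case (relator u v r x)
  then obtain s t k where r: "r = concat (replicate k [(s, True), (t, True)])"
    and st: "s \<in> S" "t \<in> S"
    by (auto simp: coxeter_relators_def)
  have r_map: "gens r = concat (replicate k [gen s, gen t])"
    unfolding r by (simp add: map_concat)
  have "pres_eq S R ([] @ r @ []) ([] @ [])" using relator by (intro pres_eq.relator) auto
  then have "pres_class S R r = pres_class S R []" using relator by (simp add: pres_class_eq_iff)
  then have one: "prd W (gens r) = \<one>\<^bsub>W\<^esub>"
    using relator pres_class_prd[of r] pres_class_prd[of "[]"] by simp
  then have even: "even (refl_count W (gens r) y)" if "y \<in> carrier W" for y
    using W.even_refl_count_relator[of "gen s" "gen t" y k] st that unfolding r_map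
    by (simp add: W.prd_alternating)
  show ?case using relator one even
    by (simp add: W.refl_count_append word_in_gens del: map_map)
qed auto

text \<open>Let \<open>ys\<close> be a reduced word of \<open>s\<close> times the product of
  \<open>xs\<close>. Then \<open>s\<close> is no reflection of \<open>ys\<close>: deleting a letter
  would spell the product of \<open>xs\<close> with fewer letters than its length. The letter
  \<open>s\<close> in front of \<open>ys\<close> adds \<open>s\<close> itself once, so
  \<open>s\<close> occurs an odd number of times in \<open>s # ys\<close>, hence also in
  \<open>xs\<close>, which has the same product. Deleting the letter of such an occurrence is the
  exchange.\<close>

lemma exchange_group_coxeter:
  assumes "finite S"
  shows "exchange_group W (coxeter_gens S M)"
proof
  show "finite (coxeter_gens S M)" using assms by (simp add: coxeter_gens_def)
next
  fix xs ys assume xs: "xs \<in> lists (coxeter_gens S M)" and ys: "ys \<in> lists (coxeter_gens S M)"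
    and eq: "prd W xs = prd W ys"
  obtain u v where uv: "u \<in> lists (S \<times> UNIV)" "xs = gens u"
    "v \<in> lists (S \<times> UNIV)" "ys = gens v"
    using coxeter_word_lift[OF xs] coxeter_word_lift[OF ys] by metis
  then have "pres_eq S R u v" using eq pres_class_prd pres_class_eq_iff by metis
  then show "even (length xs) = even (length ys)" using even_length_cong uv by auto
next
  fix xs s assume xs: "xs \<in> lists (coxeter_gens S M)" and s: "s \<in> coxeter_gens S M"
    and less: "W.len (s \<otimes>\<^bsub>W\<^esub> prd W xs) < W.len (prd W xs)"
  obtain ys where ys: "ys \<in> lists (coxeter_gens S M)" "prd W ys = s \<otimes>\<^bsub>W\<^esub> prd W xs"
    "length ys = W.len (s \<otimes>\<^bsub>W\<^esub> prd W xs)"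
    using W.reduced_word[of "s \<otimes>\<^bsub>W\<^esub> prd W xs"] xs s by auto
  have "refl_count W ys s = 0"
  proof (rule ccontr)
    assume "refl_count W ys s \<noteq> 0"
    then obtain i where i: "i < length ys"
      "s \<otimes>\<^bsub>W\<^esub> prd W ys = prd W (take i ys @ drop (Suc i) ys)"
      using W.refl_count_pos_delete[OF ys(1), of s] s by auto
    have "take i ys @ drop (Suc i) ys \<in> lists (coxeter_gens S M)"
      using ys(1) by (auto simp: in_lists_conv_set dest: in_set_takeD in_set_dropD)
    from W.len_le'[OF this i(2)[symmetric]] i(1) ys less xs s show False by simp
  qed
  then have "odd (refl_count W (s # ys) s)"
    using s by (simp add: W.gens_involution)
  moreover obtain u v where uv: "u \<in> lists (S \<times> UNIV)" "xs = gens u"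
    "v \<in> lists (S \<times> UNIV)" "s # ys = gens v"
    using coxeter_word_lift[OF xs] coxeter_word_lift[of "s # ys"] ys s
    by (metis Cons_in_lists_iff)
  moreover have "prd W xs = prd W (s # ys)" using ys s xs by simp
  then have "pres_eq S R u v" using uv pres_class_prd pres_class_eq_iff by metis
  ultimately have "odd (refl_count W xs s)"
    using even_refl_count_cong[of u v s] s W.gen_closed by metis
  then have "refl_count W xs s > 0" by (rule odd_pos)
  then show "\<exists>i<length xs. s \<otimes>\<^bsub>W\<^esub> prd W xs = prd W (take i xs @ drop (Suc i) xs)"
    using W.refl_count_pos_delete[OF xs] s by simp
qed

end

section \<open>Gradient coefficients and the weak order\<close>

definition gradient_coeff ::
  "('g, 'm) monoid_scheme \<Rightarrow> ('g \<Rightarrow> nat) \<Rightarrow> 'g \<Rightarrow> 'g \<Rightarrow> 'g \<Rightarrow> int" where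
  "gradient_coeff G \<psi> u v w =
    int (\<psi> (u \<otimes>\<^bsub>G\<^esub> w \<otimes>\<^bsub>G\<^esub> v)) + int (\<psi> w) - int (\<psi> (u \<otimes>\<^bsub>G\<^esub> w)) - int (\<psi> (w \<otimes>\<^bsub>G\<^esub> v))"

context group
begin

lemma gradient_coeff_one_left [simp]:
  "v \<in> carrier G \<Longrightarrow> w \<in> carrier G \<Longrightarrow> gradient_coeff G \<psi> \<one> v w = 0"
  by (simp add: gradient_coeff_def)

lemma gradient_coeff_one_right [simp]:
  "u \<in> carrier G \<Longrightarrow> w \<in> carrier G \<Longrightarrow> gradient_coeff G \<psi> u \<one> w = 0"
  by (simp add: gradient_coeff_def)

lemma gradient_coeff_mult_left:
  "\<lbrakk>s \<in> carrier G; u \<in> carrier G; v \<in> carrier G; w \<in> carrier G\<rbrakk> \<Longrightarrow>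
    gradient_coeff G \<psi> (s \<otimes> u) v w = gradient_coeff G \<psi> s v (u \<otimes> w) + gradient_coeff G \<psi> u v w"
  by (simp add: gradient_coeff_def m_assoc)

lemma gradient_coeff_mult_right:
  "\<lbrakk>u \<in> carrier G; t \<in> carrier G; v \<in> carrier G; w \<in> carrier G\<rbrakk> \<Longrightarrow>
    gradient_coeff G \<psi> u (t \<otimes> v) w = gradient_coeff G \<psi> u t w + gradient_coeff G \<psi> u v (w \<otimes> t)"
  by (simp add: gradient_coeff_def m_assoc)

lemma finite_left_translate:
  assumes "u \<in> carrier G" "finite {w \<in> carrier G. P w}"
  shows "finite {w \<in> carrier G. P (u \<otimes> w)}"
proof (rule finite_subset)
  show "{w \<in> carrier G. P (u \<otimes> w)} \<subseteq> (\<lambda>w. inv u \<otimes> w) ` {w \<in> carrier G. P w}"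
  proof
    fix w assume "w \<in> {w \<in> carrier G. P (u \<otimes> w)}"
    then show "w \<in> (\<lambda>w. inv u \<otimes> w) ` {w \<in> carrier G. P w}"
      using assms(1) by (intro image_eqI[of _ _ "u \<otimes> w"]) (auto simp: m_assoc[symmetric])
  qed
qed (use assms in simp)

lemma finite_right_translate:
  assumes "u \<in> carrier G" "finite {w \<in> carrier G. P w}"
  shows "finite {w \<in> carrier G. P (w \<otimes> u)}"
proof (rule finite_subset)
  show "{w \<in> carrier G. P (w \<otimes> u)} \<subseteq> (\<lambda>w. w \<otimes> inv u) ` {w \<in> carrier G. P w}"
  proof
    fix w assume "w \<in> {w \<in> carrier G. P (w \<otimes> u)}"
    then show "w \<in> (\<lambda>w. w \<otimes> inv u) ` {w \<in> carrier G. P w}"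
      using assms(1) by (intro image_eqI[of _ _ "w \<otimes> u"]) (auto simp: m_assoc)
  qed
qed (use assms in simp)

end

context involution_generated
begin

text \<open>Finite sets stay finite under translation, so the cocycle rules can be applied letter by
  letter: \<open>left\<close> extends the left argument from \<open>X\<close> to all of
  \<open>G\<close>, and only then \<open>right\<close> extends the right one.\<close>

lemma finite_gradient_support:
  assumes fin: "\<And>s t. s \<in> X \<Longrightarrow> t \<in> X \<Longrightarrow> finite {w \<in> carrier G. gradient_coeff G \<psi> s t w \<noteq> 0}"
    and "u \<in> carrier G" "v \<in> carrier G"
  shows "finite {w \<in> carrier G. gradient_coeff G \<psi> u v w \<noteq> 0}"
proof -
  have left: "finite {w \<in> carrier G. gradient_coeff G \<psi> (prd G xs) t w \<noteq> 0}"
    if "xs \<in> lists X" "t \<in> X" for xs t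
    using that(1)
  proof (induction xs rule: list.induct)
    case (Cons s xs)
    then have sx: "s \<in> X" "xs \<in> lists X" by auto
    have "finite {w \<in> carrier G. gradient_coeff G \<psi> s t (prd G xs \<otimes> w) \<noteq> 0}"
      by (rule finite_left_translate[where P = "\<lambda>w. gradient_coeff G \<psi> s t w \<noteq> 0"])
        (use fin sx that in auto)
    then have "finite ({w \<in> carrier G. gradient_coeff G \<psi> s t (prd G xs \<otimes> w) \<noteq> 0} \<union>
        {w \<in> carrier G. gradient_coeff G \<psi> (prd G xs) t w \<noteq> 0})"
      using Cons.IH[OF sx(2)] by simp
    then show ?case
      by (rule rev_finite_subset) (use sx that in \<open>auto simp: gradient_coeff_mult_left\<close>)
  qed (use that in \<open>simp cong: conj_cong\<close>)
  have right: "finite {w \<in> carrier G. gradient_coeff G \<psi> u (prd G xs) w \<noteq> 0}"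
    if "xs \<in> lists X" for xs
    using that
  proof (induction xs rule: list.induct)
    case (Cons t xs)
    then have sx: "t \<in> X" "xs \<in> lists X" by auto
    have "finite {w \<in> carrier G. gradient_coeff G \<psi> u (prd G xs) (w \<otimes> t) \<noteq> 0}"
      by (rule finite_right_translate[where P = "\<lambda>w. gradient_coeff G \<psi> u (prd G xs) w \<noteq> 0"])
        (use Cons.IH sx that in auto)
    moreover have "finite {w \<in> carrier G. gradient_coeff G \<psi> u t w \<noteq> 0}"
      using left[OF _ sx(1)] gens_generate[OF \<open>u \<in> carrier G\<close>] by metis
    ultimately have "finite ({w \<in> carrier G. gradient_coeff G \<psi> u (prd G xs) (w \<otimes> t) \<noteq> 0} \<union>
        {w \<in> carrier G. gradient_coeff G \<psi> u t w \<noteq> 0})"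
      by simp
    then show ?case
      by (rule rev_finite_subset)
        (use sx assms(2) in \<open>auto simp: gradient_coeff_mult_right\<close>)
  qed (use assms in \<open>simp cong: conj_cong\<close>)
  then show ?thesis using gens_generate[OF assms(3)] by metis
qed

section \<open>Paths, geodesics and the weak order in terms of length\<close>

lemma cayley_adj_iff:
  "u \<in> carrier G \<Longrightarrow> v \<in> carrier G \<Longrightarrow> cayley_adj G X u v \<longleftrightarrow> (\<exists>s\<in>X. v = u \<otimes> s)"
  unfolding cayley_adj_def by (metis gen_closed inv_gen inv_solve_right)

lemma cayley_path_Cons:
  "cayley_path G X (v # w # vs) \<longleftrightarrow>
    v \<in> carrier G \<and> (\<exists>s\<in>X. w = v \<otimes> s) \<and> cayley_path G X (w # vs)"
  unfolding cayley_path_def using cayley_adj_iff by auto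

text \<open>A path with n vertices has n - 1 edges, whence the strict inequality. By left invariance
  the distance of two vertices is the length of their quotient.\<close>

lemma cayley_path_len:
  "cayley_path G X vs \<Longrightarrow> len (inv (hd vs) \<otimes> last vs) < length vs"
proof (induction vs rule: induct_list012)
  case (3 v w vs)
  then obtain s where s: "v \<in> carrier G" "s \<in> X" "w = v \<otimes> s" "cayley_path G X (w # vs)"
    by (auto simp: cayley_path_Cons)
  let ?l = "last (w # vs)"
  have l: "?l \<in> carrier G" using s(4) unfolding cayley_path_def in_lists_conv_set
    by (metis last_in_set)
  have "inv v \<otimes> ?l = s \<otimes> (inv w \<otimes> ?l)"
    using s l by (simp add: inv_mult_group m_assoc)
  then have "len (inv v \<otimes> ?l) \<le> 1 + len (inv w \<otimes> ?l)"
    using len_mult[of s "inv w \<otimes> ?l"] len_gen_le[of s] s l by simp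
  then show ?case using "3.IH"(2)[OF s(4)] by simp
qed (auto simp: cayley_path_def)

text \<open>The clause on prefixes is what lets \<open>weak_le_iff\<close> place a given element on
  a geodesic.\<close>

lemma cayley_path_word:
  assumes "xs \<in> lists X" "u \<in> carrier G"
  obtains vs where "cayley_path G X vs" "hd vs = u" "last vs = u \<otimes> prd G xs"
    "length vs = Suc (length xs)"
    "\<And>ys zs. xs = ys @ zs \<Longrightarrow> u \<otimes> prd G ys \<in> set vs"
proof -
  have "\<exists>vs. cayley_path G X vs \<and> hd vs = u \<and> last vs = u \<otimes> prd G xs
    \<and> length vs = Suc (length xs) \<and> (\<forall>ys zs. xs = ys @ zs \<longrightarrow> u \<otimes> prd G ys \<in> set vs)"
    using assms
  proof (induction xs arbitrary: u rule: list.induct)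
    case Nil
    then show ?case by (intro exI[of _ "[u]"]) (auto simp: cayley_path_def)
  next
    case (Cons x xs)
    then have x: "x \<in> X" "xs \<in> lists X" by auto
    obtain vs where vs: "cayley_path G X vs" "hd vs = u \<otimes> x" "last vs = u \<otimes> x \<otimes> prd G xs"
      "length vs = Suc (length xs)" "\<forall>ys zs. xs = ys @ zs \<longrightarrow> u \<otimes> x \<otimes> prd G ys \<in> set vs"
      using Cons.IH[of "u \<otimes> x"] x Cons.prems by auto
    then obtain v vs' where v: "vs = v # vs'" by (cases vs) auto
    show ?case
    proof (intro exI[of _ "u # vs"] conjI allI impI)
      fix ys zs assume "x # xs = ys @ zs"
      then consider "ys = []" | ys' where "ys = x # ys'" "xs = ys' @ zs"
        by (cases ys) auto
      then show "u \<otimes> prd G ys \<in> set (u # vs)"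
      proof cases
        case 2
        then have "ys' \<in> lists X" "u \<otimes> x \<otimes> prd G ys' \<in> set vs" using x vs(5) by auto
        then show ?thesis using 2 x Cons.prems by (simp add: m_assoc)
      qed (use Cons.prems in simp)
    qed (use vs v x Cons.prems in \<open>auto simp: cayley_path_Cons m_assoc\<close>)
  qed
  then show ?thesis using that by blast
qed

lemma cayley_path_closed:
  assumes "cayley_path G X vs" "v \<in> set vs" shows "v \<in> carrier G"
  using assms unfolding cayley_path_def in_lists_conv_set by auto

lemma geodesic_iff:
  "geodesic G X vs \<longleftrightarrow> cayley_path G X vs \<and> length vs = Suc (len (inv (hd vs) \<otimes> last vs))"
proof (cases "cayley_path G X vs")
  case True
  then have [simp]: "hd vs \<in> carrier G" "last vs \<in> carrier G"
    using cayley_path_closed[OF True] unfolding cayley_path_def by auto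
  obtain xs where xs: "xs \<in> lists X" "prd G xs = inv (hd vs) \<otimes> last vs"
    "length xs = len (inv (hd vs) \<otimes> last vs)"
    using reduced_word[of "inv (hd vs) \<otimes> last vs"] by auto
  obtain us where us: "cayley_path G X us" "hd us = hd vs" "last us = hd vs \<otimes> prd G xs"
    "length us = Suc (length xs)"
    using cayley_path_word[OF xs(1), of "hd vs"] \<open>hd vs \<in> carrier G\<close> by metis
  moreover have "last us = last vs" using us(3) xs(2) by (simp add: m_assoc[symmetric])
  ultimately have "geodesic G X vs \<Longrightarrow> length vs \<le> Suc (len (inv (hd vs) \<otimes> last vs))"
    unfolding geodesic_def using xs(3) by metis
  moreover have "length vs \<le> length ws"
    if "length vs = Suc (len (inv (hd vs) \<otimes> last vs))" "cayley_path G X ws"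
      "hd ws = hd vs" "last ws = last vs" for ws
    using cayley_path_len[OF that(2)] that by simp
  ultimately show ?thesis
    using True cayley_path_len[OF True] unfolding geodesic_def by force
qed (simp add: geodesic_def)

lemma cayley_path_append_left: "cayley_path G X (vs @ ws) \<Longrightarrow> vs \<noteq> [] \<Longrightarrow> cayley_path G X vs"
  unfolding cayley_path_def by (auto simp: successively_append_iff)

lemma cayley_path_append_right: "cayley_path G X (vs @ ws) \<Longrightarrow> ws \<noteq> [] \<Longrightarrow> cayley_path G X ws"
  unfolding cayley_path_def by (auto simp: successively_append_iff)

text \<open>A vertex on a geodesic cuts it into two paths whose lengths the triangle inequality
  leaves no slack; conversely, reduced words of \<open>w\<close> and of
  \<open>inv w \<otimes> v\<close> concatenate to a geodesic through \<open>w\<close>. In this form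
  the weak order is a relation between lengths and can be compared with
  \<open>gradient_coeff\<close>.\<close>

lemma weak_le_iff:
  "weak_le G X w v \<longleftrightarrow> w \<in> carrier G \<and> v \<in> carrier G \<and> len w + len (inv w \<otimes> v) = len v"
proof
  assume "weak_le G X w v"
  then obtain vs where vs: "geodesic G X vs" "hd vs = \<one>" "last vs = v" "w \<in> set vs"
    unfolding weak_le_def by blast
  then have path: "cayley_path G X vs" unfolding geodesic_iff by blast
  then have [simp]: "w \<in> carrier G" "v \<in> carrier G"
    using vs cayley_path_closed[OF path] unfolding cayley_path_def by auto
  obtain as bs where ab: "vs = as @ w # bs" using vs(4) by (auto simp: in_set_conv_decomp)
  have "hd (as @ [w]) = \<one>" using vs(2) ab by (cases as) auto
  then have "len w < length (as @ [w])"
    using cayley_path_len[OF cayley_path_append_left[of "as @ [w]" bs]] path ab by simp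
  moreover have "len (inv w \<otimes> v) < length (w # bs)"
    using cayley_path_len[OF cayley_path_append_right[of as "w # bs"]] path ab vs(3) by simp
  moreover have "length vs = Suc (len v)" using vs unfolding geodesic_iff by simp
  moreover have "len v \<le> len w + len (inv w \<otimes> v)"
    using len_mult[of w "inv w \<otimes> v"] by (simp add: m_assoc[symmetric])
  ultimately show "w \<in> carrier G \<and> v \<in> carrier G \<and> len w + len (inv w \<otimes> v) = len v"
    using ab by simp
next
  assume *: "w \<in> carrier G \<and> v \<in> carrier G \<and> len w + len (inv w \<otimes> v) = len v"
  then obtain xs ys where xs: "xs \<in> lists X" "prd G xs = w" "length xs = len w"
    and ys: "ys \<in> lists X" "prd G ys = inv w \<otimes> v" "length ys = len (inv w \<otimes> v)"
    using reduced_word[of w] reduced_word[of "inv w \<otimes> v"] by (metis inv_closed m_closed)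
  have v: "prd G (xs @ ys) = v" using xs ys * by (simp add: prd_append m_assoc[symmetric])
  obtain vs where vs: "cayley_path G X vs" "hd vs = \<one>" "last vs = \<one> \<otimes> prd G (xs @ ys)"
    "length vs = Suc (length (xs @ ys))" "\<And>us zs. xs @ ys = us @ zs \<Longrightarrow> \<one> \<otimes> prd G us \<in> set vs"
    using cayley_path_word[of "xs @ ys" \<one>] xs ys by (metis append_in_lists_conv one_closed)
  have "geodesic G X vs" unfolding geodesic_iff using vs(1-4) v xs ys * by simp
  then show "weak_le G X w v"
    unfolding weak_le_def using vs(2,3) vs(5)[of xs ys] v xs * by (intro exI[of _ vs]) (auto)
qed

end

section \<open>Limits at the boundary\<close>

context involution_generated
begin

lemma cayley_path_snoc:
  assumes "vs \<noteq> []"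
  shows "cayley_path G X (vs @ [w]) \<longleftrightarrow> cayley_path G X vs \<and> (\<exists>s\<in>X. w = last vs \<otimes> s)"
proof -
  have "last vs \<in> carrier G" if "cayley_path G X vs"
    using cayley_path_closed[OF that] assms by simp
  then show ?thesis
    unfolding cayley_path_def using assms cayley_adj_iff
    by (auto simp: successively_append_iff cayley_path_def)
qed

lemma cayley_path_map_upt:
  "cayley_path G X (map \<alpha> [0..<Suc n]) \<longleftrightarrow>
    \<alpha> 0 \<in> carrier G \<and> (\<forall>i<n. \<exists>s\<in>X. \<alpha> (Suc i) = \<alpha> i \<otimes> s)"
proof (induction n)
  case (Suc n)
  have "map \<alpha> [0..<Suc (Suc n)] = map \<alpha> [0..<Suc n] @ [\<alpha> (Suc n)]" by simp
  then show ?case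
    using cayley_path_snoc[of "map \<alpha> [0..<Suc n]"] Suc.IH by (auto simp: less_Suc_eq)
qed (auto simp: cayley_path_def)

lemma inf_geodesic_iff:
  "inf_geodesic G X \<alpha> \<longleftrightarrow> \<alpha> 0 \<in> carrier G \<and> (\<forall>n. \<exists>s\<in>X. \<alpha> (Suc n) = \<alpha> n \<otimes> s) \<and>
    (\<forall>n. len (inv (\<alpha> 0) \<otimes> \<alpha> n) = n)"
proof -
  have "hd (map \<alpha> [0..<Suc n]) = \<alpha> 0" "last (map \<alpha> [0..<Suc n]) = \<alpha> n" for n
    by (simp_all add: hd_map hd_upt del: upt_Suc) simp
  then have "geodesic G X (map \<alpha> [0..<Suc n]) \<longleftrightarrow>
      \<alpha> 0 \<in> carrier G \<and> (\<forall>i<n. \<exists>s\<in>X. \<alpha> (Suc i) = \<alpha> i \<otimes> s) \<and> len (inv (\<alpha> 0) \<otimes> \<alpha> n) = n" for n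
    unfolding geodesic_iff cayley_path_map_upt by (auto simp del: upt_Suc)
  then show ?thesis unfolding inf_geodesic_def by blast
qed

lemma inf_geodesic_closed:
  assumes "inf_geodesic G X \<alpha>" shows "\<alpha> n \<in> carrier G"
proof (induction n)
  case (Suc n)
  then show ?case using assms unfolding inf_geodesic_iff by (metis gen_closed m_closed)
qed (use assms in \<open>simp add: inf_geodesic_iff\<close>)

text \<open>The distance from g to the n-th point of a geodesic ray, minus n, is nonincreasing and bounded
  below, hence eventually constant.\<close>

lemma busemann_eventually_const:
  assumes "inf_geodesic G X \<alpha>" "g \<in> carrier G"
  obtains c where "\<forall>\<^sub>F n in sequentially. int (len (inv g \<otimes> \<alpha> n)) = int n + c"
proof -
  note cl [simp] = inf_geodesic_closed[OF assms(1)] assms(2)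
  define d where "d n = len (inv g \<otimes> \<alpha> n)" for n
  \<comment> \<open>The summand \<open>d 0\<close> keeps the subtraction of naturals from
    truncating, by the triangle inequality in \<open>lower\<close>.\<close>
  define f where "f n = d n + d 0 - n" for n
  have lower: "n \<le> d n + d 0" for n
  proof -
    have "inv (\<alpha> 0) \<otimes> \<alpha> n = inv (inv g \<otimes> \<alpha> 0) \<otimes> (inv g \<otimes> \<alpha> n)"
      by (simp add: inv_mult_group m_assoc)
        (simp add: m_assoc[symmetric])
    then have "len (inv (\<alpha> 0) \<otimes> \<alpha> n) \<le> d 0 + d n"
      using len_mult[of "inv (inv g \<otimes> \<alpha> 0)" "inv g \<otimes> \<alpha> n"] by (simp add: d_def del: inv_mult_group)
    then show ?thesis using assms(1) by (simp add: inf_geodesic_iff)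
  qed
  have step: "d (Suc n) \<le> Suc (d n)" for n
  proof -
    obtain s where s: "s \<in> X" "\<alpha> (Suc n) = \<alpha> n \<otimes> s" using assms(1) inf_geodesic_iff by blast
    then have "inv g \<otimes> \<alpha> (Suc n) = inv g \<otimes> \<alpha> n \<otimes> s" by (simp add: m_assoc)
    then show ?thesis using len_mult[of "inv g \<otimes> \<alpha> n" s] len_gen_le[of s] s by (simp add: d_def)
  qed
  have "decseq f" unfolding decseq_Suc_iff
  proof
    fix n show "f (Suc n) \<le> f n" using step[of n] lower[of n] lower[of "Suc n"] by (simp add: f_def)
  qed
  define m where "m = (LEAST k. k \<in> range f)"
  have "m \<in> range f" unfolding m_def by (rule LeastI[of _ "f 0"]) simp
  then obtain N where N: "f N = m" by auto
  have const: "f n = m" if "n \<ge> N" for n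
  proof (rule antisym)
    show "f n \<le> m" using \<open>decseq f\<close> that N unfolding decseq_def by blast
    show "m \<le> f n" unfolding m_def by (rule Least_le) simp
  qed
  then have "int (d n) = int n + (int m - int (d 0))" if "n \<ge> N" for n
    using const[OF that] lower[of n] unfolding f_def by linarith
  then show ?thesis
    by (intro that[of "int m - int (d 0)"]) (auto simp: d_def eventually_sequentially)
qed

text \<open>For large n the lengths of \<open>\<alpha> n\<close> and of
  \<open>inv w \<otimes> \<alpha> n\<close> are n + d and n + c, so
  \<open>weak_le G X w (\<alpha> n)\<close> amounts to len w + c = d, a condition free of n.\<close>

lemma weak_le_inf_dichotomy:
  assumes "inf_geodesic G X \<alpha>" "w \<in> carrier G"
  shows "\<forall>\<^sub>F n in sequentially. weak_le G X w (\<alpha> n) \<longleftrightarrow> weak_le_inf G X w \<alpha>"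
proof -
  obtain c where c: "\<forall>\<^sub>F n in sequentially. int (len (inv w \<otimes> \<alpha> n)) = int n + c"
    using busemann_eventually_const assms by blast
  obtain d where d: "\<forall>\<^sub>F n in sequentially. int (len (inv \<one> \<otimes> \<alpha> n)) = int n + d"
    using busemann_eventually_const[OF assms(1) one_closed] by blast
  have ev: "\<forall>\<^sub>F n in sequentially. weak_le G X w (\<alpha> n) \<longleftrightarrow> int (len w) + c = d"
    using c d
  proof eventually_elim
    case (elim n)
    then show ?case
      using inf_geodesic_closed[OF assms(1)] assms(2) unfolding weak_le_iff by auto
  qed
  then have "weak_le_inf G X w \<alpha> \<longleftrightarrow> int (len w) + c = d"
    unfolding weak_le_inf_def by (simp add: eventually_subst)
  then show ?thesis using ev by simp
qed

section \<open>Boundary points and convergence to them\<close>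

lemma boundary_inf_geodesic: "z \<in> boundary G X \<Longrightarrow> \<alpha> \<in> z \<Longrightarrow> inf_geodesic G X \<alpha>"
  by (auto simp: boundary_def quotient_def geodesic_equiv_def)

lemma boundary_nonempty: "z \<in> boundary G X \<Longrightarrow> \<exists>\<alpha>. \<alpha> \<in> z"
  by (auto simp: boundary_def quotient_def geodesic_equiv_def)

lemma below_boundary:
  assumes "z \<in> boundary G X" "\<alpha> \<in> z" "w \<in> carrier G"
  shows "below G X w (Inr z) \<longleftrightarrow> weak_le_inf G X w \<alpha>"
  using assms by (auto simp: boundary_def quotient_def geodesic_equiv_def)

lemma inf_geodesic_boundary:
  assumes "inf_geodesic G X \<alpha>"
  obtains z where "z \<in> boundary G X" "\<alpha> \<in> z"
proof
  show "geodesic_equiv G X `` {\<alpha>} \<in> boundary G X"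
    unfolding boundary_def using assms by (intro quotientI) simp
  show "\<alpha> \<in> geodesic_equiv G X `` {\<alpha>}" using assms by (simp add: geodesic_equiv_def)
qed

text \<open>Limits may be tested on the subbase. The set for \<open>w\<close> and its complement
  together force the truth value of \<open>weak_le G X w (x i)\<close> to settle at the one for
  \<open>z\<close>, which any representative \<open>\<alpha>\<close> computes.\<close>

lemma limitin_boundary_iff:
  assumes z: "z \<in> boundary G X" "\<alpha> \<in> z" and x: "\<And>i. x i \<in> carrier G"
  shows "limitin (compactification_topology G X) (\<lambda>i. Inl (x i)) (Inr z) sequentially \<longleftrightarrow>
    (\<forall>w\<in>carrier G. \<forall>\<^sub>F i in sequentially. weak_le G X w (x i) \<longleftrightarrow> weak_le_inf G X w \<alpha>)"
    (is "?L \<longleftrightarrow> ?R")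
proof
  have in_comp: "Inl (x i) \<in> compactification G X" "Inr z \<in> compactification G X" for i
    using z x by (auto simp: compactification_def)
  {
    assume L: ?L
    show ?R
    proof
      fix w assume w: "w \<in> carrier G"
      have "openin (compactification_topology G X) {\<xi> \<in> compactification G X. below G X w \<xi>}"
        "openin (compactification_topology G X) {\<xi> \<in> compactification G X. \<not> below G X w \<xi>}"
        unfolding compactification_topology_def using w
        by (auto intro!: topology_generated_by_Basis)
      then have "below G X w (Inr z) \<Longrightarrow>
          \<forall>\<^sub>F i in sequentially. Inl (x i) \<in> {\<xi> \<in> compactification G X. below G X w \<xi>}"
        "\<not> below G X w (Inr z) \<Longrightarrow>
          \<forall>\<^sub>F i in sequentially. Inl (x i) \<in> {\<xi> \<in> compactification G X. \<not> below G X w \<xi>}"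
        using L in_comp(2) unfolding limitin_def by blast+
      then show "\<forall>\<^sub>F i in sequentially. weak_le G X w (x i) \<longleftrightarrow> weak_le_inf G X w \<alpha>"
        using below_boundary[OF z w] in_comp(1) by (cases "below G X w (Inr z)") simp_all
    qed
  }
  {
    assume R: ?R
    have ev: "Inr z \<in> U \<Longrightarrow> \<forall>\<^sub>F i in sequentially. Inl (x i) \<in> U"
      if "generate_topology_on
        ((\<lambda>w. {\<xi> \<in> compactification G X. below G X w \<xi>}) ` carrier G \<union>
         (\<lambda>w. {\<xi> \<in> compactification G X. \<not> below G X w \<xi>}) ` carrier G) U" for U
      using that
    proof (induction rule: generate_topology_on.induct)
      case (Int a b)
      then show ?case by (auto intro: eventually_conj)
    next
      case (UN K)
      then obtain k where "k \<in> K" "Inr z \<in> k" by auto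
      with UN have "\<forall>\<^sub>F i in sequentially. Inl (x i) \<in> k" by blast
      then show ?case by (rule eventually_mono) (use \<open>k \<in> K\<close> in auto)
    next
      case (Basis s)
      then obtain w where w: "w \<in> carrier G"
        "s = {\<xi> \<in> compactification G X. below G X w \<xi>} \<or>
         s = {\<xi> \<in> compactification G X. \<not> below G X w \<xi>}" by auto
      have "\<forall>\<^sub>F i in sequentially. weak_le G X w (x i) \<longleftrightarrow> weak_le_inf G X w \<alpha>" using R w by blast
      then show ?case
        by (rule eventually_mono) (use w in_comp below_boundary[OF z w(1)] Basis.prems in auto)
    qed simp
    have "Inr z \<in> topspace (compactification_topology G X)"
      unfolding compactification_topology_def topology_generated_by_topspace using in_comp by auto
    then show ?L
      unfolding limitin_def using ev
      by (auto simp: compactification_topology_def openin_topology_generated_by_iff)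
  }
qed

text \<open>If \<open>x i\<close> returned to \<open>v\<close> infinitely often, \<open>v\<close>
  and \<open>\<alpha>\<close> would have the same elements below them. Then \<open>v\<close> is
  below \<open>\<alpha>\<close>, and a geodesic from \<open>v\<close> to \<open>\<alpha> i\<close>
  starts with some \<open>s\<close> such that \<open>v \<otimes> s\<close> is longer than
  \<open>v\<close> and below \<open>\<alpha> i\<close>. Since \<open>X\<close> is finite, one
  \<open>s\<close> serves infinitely many i, so \<open>v \<otimes> s\<close> is below
  \<open>\<alpha>\<close> and hence below \<open>v\<close>, which is impossible.\<close>

lemma boundary_limit_leaves_points:
  assumes "finite X" and z: "z \<in> boundary G X" "\<alpha> \<in> z"
    and lim: "\<And>w. w \<in> carrier G \<Longrightarrow>
      \<forall>\<^sub>F i in sequentially. weak_le G X w (x i) \<longleftrightarrow> weak_le_inf G X w \<alpha>"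
    and v [simp]: "v \<in> carrier G"
  shows "\<forall>\<^sub>F i in sequentially. x i \<noteq> v"
proof (rule ccontr)
  note geo = boundary_inf_geodesic[OF z]
  note cl [simp] = inf_geodesic_closed[OF geo]
  assume "\<not> ?thesis"
  then have freq: "\<exists>\<^sub>F i in sequentially. x i = v" by (simp add: frequently_def)
  have same: "weak_le G X w v \<longleftrightarrow> weak_le_inf G X w \<alpha>" if "w \<in> carrier G" for w
    using frequently_eventually_conj[OF freq lim[OF that]] by (auto dest: frequently_ex)
  have "weak_le G X v v" by (simp add: weak_le_iff)
  then have "\<forall>\<^sub>F i in sequentially. weak_le G X v (\<alpha> i)"
    using same by (simp add: weak_le_inf_def)
  \<comment> \<open>The ray has distance i from its origin at time i, so from here on it cannot be
    at \<open>v\<close>.\<close>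
  moreover have "\<forall>\<^sub>F i in sequentially. i > len (inv (\<alpha> 0) \<otimes> v)"
    by (rule eventually_gt_at_top)
  ultimately have "\<forall>\<^sub>F i in sequentially. \<exists>s\<in>X. weak_le G X (v \<otimes> s) (\<alpha> i) \<and> len v < len (v \<otimes> s)"
  proof eventually_elim
    case (elim i)
    then have "\<alpha> i \<noteq> v" using geo unfolding inf_geodesic_iff by (metis less_irrefl)
    then have ne: "inv v \<otimes> \<alpha> i \<noteq> \<one>" by (metis cl inv_closed inv_equality inv_inv v)
    obtain xs where xs: "xs \<in> lists X" "prd G xs = inv v \<otimes> \<alpha> i" "length xs = len (inv v \<otimes> \<alpha> i)"
      using reduced_word[of "inv v \<otimes> \<alpha> i"] by auto
    then obtain s ys where sys: "xs = s # ys" "s \<in> X" "ys \<in> lists X" using ne by (cases xs) auto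
    have "inv (v \<otimes> s) \<otimes> \<alpha> i = s \<otimes> (inv v \<otimes> \<alpha> i)"
      using sys by (simp add: inv_mult_group m_assoc)
    also have "\<dots> = prd G ys" using xs(2)[symmetric] sys by simp
    finally have ys: "inv (v \<otimes> s) \<otimes> \<alpha> i = prd G ys" .
    then have 1: "len (inv (v \<otimes> s) \<otimes> \<alpha> i) < len (inv v \<otimes> \<alpha> i)"
      using len_le[of ys] sys xs(3) by simp
    have "(v \<otimes> s) \<otimes> (inv (v \<otimes> s) \<otimes> \<alpha> i) = \<alpha> i" using sys by (simp add: m_assoc[symmetric])
    then have 2: "len (\<alpha> i) \<le> len (v \<otimes> s) + len (inv (v \<otimes> s) \<otimes> \<alpha> i)"
      using len_mult[of "v \<otimes> s" "inv (v \<otimes> s) \<otimes> \<alpha> i"] sys by simp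
    have 3: "len (v \<otimes> s) \<le> len v + 1" using len_mult[of v s] len_gen_le[of s] sys by simp
    have 4: "len v + len (inv v \<otimes> \<alpha> i) = len (\<alpha> i)" using elim by (simp add: weak_le_iff)
    show ?case
      using sys 1 2 3 4 by (intro bexI[of _ s]) (auto simp: weak_le_iff)
  qed
  then have "\<exists>s\<in>X. \<exists>\<^sub>F i in sequentially. weak_le G X (v \<otimes> s) (\<alpha> i) \<and> len v < len (v \<otimes> s)"
    using frequently_bex_finite_distrib[OF \<open>finite X\<close>,
        of "\<lambda>i s. weak_le G X (v \<otimes> s) (\<alpha> i) \<and> len v < len (v \<otimes> s)" sequentially]
    by (blast dest: eventually_frequently[OF sequentially_bot])
  then obtain s where s: "s \<in> X"
    and fr: "\<exists>\<^sub>F i in sequentially. weak_le G X (v \<otimes> s) (\<alpha> i) \<and> len v < len (v \<otimes> s)"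
    by blast
  have "v \<otimes> s \<in> carrier G" using s by simp
  from frequently_eventually_conj[OF fr weak_le_inf_dichotomy[OF geo this]]
  have "weak_le_inf G X (v \<otimes> s) \<alpha>" "len v < len (v \<otimes> s)" by (auto dest: frequently_ex)
  then show False using same[of "v \<otimes> s"] s by (auto simp: weak_le_iff)
qed

text \<open>For u = inv g a vanishing coefficient at \<open>x i\<close> says that len (inv g y) -
  len y is the same for y = x i and y = x i w. By \<open>weak_le_iff\<close> this difference decides
  whether \<open>g\<close> is below y. The finite support is eventually avoided because
  \<open>x\<close> leaves every point.\<close>

lemma small_at_infinity_if_finite_support:
  assumes "finite X"
    and fin: "\<And>u v. u \<in> carrier G \<Longrightarrow> v \<in> carrier G \<Longrightarrow>
      finite {w \<in> carrier G. gradient_coeff G len u v w \<noteq> 0}"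
  shows "small_at_infinity G X"
  unfolding small_at_infinity_def
proof (intro allI ballI impI)
  fix x z w assume z: "z \<in> boundary G X" and w [simp]: "w \<in> carrier G"
    and *: "(\<forall>i. x i \<in> carrier G) \<and>
      limitin (compactification_topology G X) (\<lambda>i. Inl (x i)) (Inr z) sequentially"
  then have x [simp]: "x i \<in> carrier G" for i by blast
  obtain \<alpha> where \<alpha>: "\<alpha> \<in> z" using boundary_nonempty[OF z] by blast
  have lim: "\<forall>\<^sub>F i in sequentially. weak_le G X g (x i) \<longleftrightarrow> weak_le_inf G X g \<alpha>"
    if "g \<in> carrier G" for g
    using * limitin_boundary_iff[OF z \<alpha>, of x] that by simp
  have "\<forall>\<^sub>F i in sequentially. weak_le G X g (x i \<otimes> w) \<longleftrightarrow> weak_le_inf G X g \<alpha>"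
    if g: "g \<in> carrier G" for g
  proof -
    let ?F = "{y \<in> carrier G. gradient_coeff G len (inv g) w y \<noteq> 0}"
    have "\<forall>\<^sub>F i in sequentially. \<forall>y\<in>?F. x i \<noteq> y"
      by (rule eventually_ball_finite)
        (use fin g boundary_limit_leaves_points[OF \<open>finite X\<close> z \<alpha> lim] in auto)
    with lim[OF g] show ?thesis
    proof eventually_elim
      case (elim i)
      then have "gradient_coeff G len (inv g) w (x i) = 0" using x[of i] by blast
      then have "weak_le G X g (x i \<otimes> w) \<longleftrightarrow> weak_le G X g (x i)"
        using g by (auto simp: weak_le_iff gradient_coeff_def m_assoc)
      then show ?case using elim by simp
    qed
  qed
  then show "limitin (compactification_topology G X) (\<lambda>i. Inl (x i \<otimes> w)) (Inr z) sequentially"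
    using limitin_boundary_iff[OF z \<alpha>, of "\<lambda>i. x i \<otimes> w"] by simp
qed

end

section \<open>Folding and minimal coset representatives\<close>

text \<open>Words are indexed by their last letter because the steps compared below all end in
  \<open>r\<close>; a shorter one is then a suffix of a longer one.\<close>

fun alternating :: "'a \<Rightarrow> 'a \<Rightarrow> nat \<Rightarrow> 'a list" where
  "alternating r s 0 = []"
| "alternating r s (Suc n) = alternating s r n @ [r]"

lemma alternating_eq:
  assumes "u \<in> lists {r, s}" "distinct_adj u" "u = [] \<or> last u = r"
  shows "u = alternating r s (length u)"
  using assms
proof (induction u arbitrary: r s rule: rev_induct)
  case (snoc x u)
  then have "x = r" "u \<in> lists {s, r}" by (auto simp: insert_commute)
  moreover have "u = [] \<or> last u = s"
  proof (cases "u = []")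
    case False
    then have "last u \<in> {r, s}" "last u \<noteq> x"
      using snoc.prems by (auto simp: in_lists_conv_set distinct_adj_append_iff)
    then show ?thesis using \<open>x = r\<close> by auto
  qed simp
  moreover have "distinct_adj u" using snoc.prems by (simp add: distinct_adj_append_iff)
  ultimately show ?case using snoc.IH[of s r] by simp
qed simp

lemma alternating_suffix: "k \<le> n \<Longrightarrow> \<exists>p. alternating r s n = p @ alternating r s k"
proof (induction k arbitrary: r s n)
  case (Suc k)
  then obtain n' where "n = Suc n'" "k \<le> n'" by (cases n) auto
  then show ?case using Suc.IH[of n' s r] by auto
qed simp

lemma finite_if_all_eq: "(\<And>x y. x \<in> A \<Longrightarrow> y \<in> A \<Longrightarrow> x = y) \<Longrightarrow> finite A"
  by (metis finite.simps insertI1 subsetI subset_singletonD)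

text \<open>Having infinitely many descendants passes from a vertex to one of its finitely many
  successors.\<close>

lemma koenig_rtrancl:
  assumes inf: "infinite (step\<^sup>* `` {x})" and fin: "\<And>y. finite (step `` {y})"
  obtains f where "f 0 = x" "\<And>n::nat. (f n, f (Suc n)) \<in> step"
proof -
  let ?P = "\<lambda>y. infinite (step\<^sup>* `` {y})"
  have "\<exists>y'. ?P y' \<and> (y, y') \<in> step" if "?P y" for y
  proof (rule ccontr)
    assume "\<not> ?thesis"
    then have "finite (\<Union>y'\<in>step `` {y}. step\<^sup>* `` {y'})" using fin by auto
    moreover have "step\<^sup>* `` {y} \<subseteq> insert y (\<Union>y'\<in>step `` {y}. step\<^sup>* `` {y'})"
      by (auto elim: converse_rtranclE)
    ultimately show False using that by (meson finite_insert finite_subset)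
  qed
  then obtain g where g: "\<And>y. ?P y \<Longrightarrow> ?P (g y) \<and> (y, g y) \<in> step" by metis
  have "?P ((g ^^ n) x)" for n by (induction n) (use inf g in auto)
  then show ?thesis using that[of "\<lambda>n. (g ^^ n) x"] g by simp
qed

context exchange_group
begin

lemma len_mult_gen_left:
  assumes "s \<in> X" "w \<in> carrier G"
  shows "len (s \<otimes> w) = Suc (len w) \<or> len w = Suc (len (s \<otimes> w))"
proof -
  obtain xs where xs: "xs \<in> lists X" "prd G xs = w" "length xs = len w"
    using reduced_word assms by blast
  obtain ys where ys: "ys \<in> lists X" "prd G ys = s \<otimes> w" "length ys = len (s \<otimes> w)"
    using reduced_word[of "s \<otimes> w"] assms by auto
  have "even (length ys) = even (length (s # xs))"
    by (rule parity) (use xs ys assms in auto)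
  then have "len (s \<otimes> w) \<noteq> len w" using xs ys by auto
  moreover have "len (s \<otimes> w) \<le> 1 + len w" using len_mult[of s w] len_gen_le[of s] assms by simp
  moreover have "len w \<le> 1 + len (s \<otimes> w)"
    using len_mult[of s "s \<otimes> w"] len_gen_le[of s] assms by simp
  ultimately show ?thesis by linarith
qed

lemma len_mult_gen_right:
  assumes "s \<in> X" "w \<in> carrier G"
  shows "len (w \<otimes> s) = Suc (len w) \<or> len w = Suc (len (w \<otimes> s))"
  using len_mult_gen_left[of s "inv w"] assms len_inv[of "w \<otimes> s"] by (simp add: inv_mult_group)

lemma gen_cancel_right [simp]: "s \<in> X \<Longrightarrow> w \<in> carrier G \<Longrightarrow> w \<otimes> s \<otimes> s = w"
  by (simp add: m_assoc gens_involution)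

lemma exchange_right:
  assumes "xs \<in> lists X" "s \<in> X" "len (prd G xs \<otimes> s) < len (prd G xs)"
  shows "\<exists>i<length xs. prd G xs \<otimes> s = prd G (take i xs @ drop (Suc i) xs)"
proof -
  have inv: "s \<otimes> prd G (rev xs) = inv (prd G xs \<otimes> s)"
    using assms by (simp add: inv_mult_group prd_rev)
  have "len (s \<otimes> prd G (rev xs)) < len (prd G (rev xs))"
    unfolding inv using assms by (simp add: prd_rev)
  then obtain i where i: "i < length xs"
    "s \<otimes> prd G (rev xs) = prd G (take i (rev xs) @ drop (Suc i) (rev xs))"
    using exchange[of "rev xs" s] assms by auto
  \<comment> \<open>Position i of the reversed word is position j of \<open>xs\<close>.\<close>
  define j where "j = length xs - Suc i"
  have j: "j < length xs" "rev (take j xs @ drop (Suc j) xs) = take i (rev xs) @ drop (Suc i) (rev xs)"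
    using i(1) by (auto simp: j_def take_rev drop_rev Suc_diff_Suc)
  have del: "take j xs @ drop (Suc j) xs \<in> lists X"
    using assms(1) by (auto simp: in_lists_conv_set dest: in_set_takeD in_set_dropD)
  have "inv (prd G xs \<otimes> s) = inv (prd G (take j xs @ drop (Suc j) xs))"
    using i(2) inv prd_rev[OF del] j(2) by simp
  then have "prd G xs \<otimes> s = prd G (take j xs @ drop (Suc j) xs)"
    using assms(1,2) prd_closed[OF del] by (metis inv_inv m_closed prd_closed gen_closed)
  then show ?thesis using j(1) by blast
qed

text \<open>Since \<open>s\<close> shortens w t, a letter of the reduced word
  \<open>xs @ [t]\<close> can be exchanged. A letter inside \<open>xs\<close> is impossible:
  cancelling the final \<open>t\<close> would make s w shorter than \<open>w\<close>. So the letter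
  is \<open>t\<close>, and s w t = w.\<close>

lemma folding_ascent:
  assumes "s \<in> X" "t \<in> X" "w \<in> carrier G" "len w < len (s \<otimes> w)" "len w < len (w \<otimes> t)"
    "len (s \<otimes> w \<otimes> t) = len w"
  shows "s \<otimes> w = w \<otimes> t"
proof -
  obtain xs where xs: "xs \<in> lists X" "prd G xs = w" "length xs = len w"
    using reduced_word assms by blast
  have wt: "prd G (xs @ [t]) = w \<otimes> t"
    using xs assms by (simp add: prd_append)
  have "len (s \<otimes> prd G (xs @ [t])) < len (prd G (xs @ [t]))"
    unfolding wt using assms by (simp add: m_assoc)
  then obtain i where i: "i < length (xs @ [t])"
    "s \<otimes> prd G (xs @ [t]) = prd G (take i (xs @ [t]) @ drop (Suc i) (xs @ [t]))"
    using exchange[of "xs @ [t]" s] xs assms by auto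
  show ?thesis
  proof (cases "i < length xs")
    case True
    have del: "take i xs @ drop (Suc i) xs \<in> lists X"
      using xs(1) by (auto simp: in_lists_conv_set dest: in_set_takeD in_set_dropD)
    have "take i (xs @ [t]) @ drop (Suc i) (xs @ [t]) = (take i xs @ drop (Suc i) xs) @ [t]"
      using True by simp
    then have "s \<otimes> (w \<otimes> t) = prd G (take i xs @ drop (Suc i) xs) \<otimes> t"
      using i(2) wt prd_append[OF del, of "[t]"] assms by simp
    then have "s \<otimes> w = prd G (take i xs @ drop (Suc i) xs)"
      using assms prd_closed[OF del] by (metis gen_closed m_assoc m_closed right_cancel)
    then have "len (s \<otimes> w) < length xs" using len_le'[OF del, of "s \<otimes> w"] True by simp
    then show ?thesis using assms xs by simp
  next
    case False
    then have "s \<otimes> (w \<otimes> t) = w" using i wt xs assms by simp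
    then show ?thesis using gen_gen_cancel[of s "w \<otimes> t"] assms(1-3) by simp
  qed
qed

text \<open>If \<open>s\<close> shortens \<open>w\<close>, the ascending case applies to
  \<open>s \<otimes> w\<close> instead.\<close>

lemma folding:
  assumes "s \<in> X" "t \<in> X" "w \<in> carrier G" "len (s \<otimes> w) = len (w \<otimes> t)" "len (s \<otimes> w \<otimes> t) = len w"
  shows "s \<otimes> w = w \<otimes> t"
proof (cases "len w < len (s \<otimes> w)")
  case False
  then have less: "len (s \<otimes> w) < len w" using len_mult_gen_left[of s w] assms by auto
  have "s \<otimes> (s \<otimes> w) = (s \<otimes> w) \<otimes> t"
    by (rule folding_ascent) (use assms less in auto)
  then have "w = s \<otimes> w \<otimes> t" using assms(1-3) by simp
  then have "w \<otimes> t = s \<otimes> w \<otimes> t \<otimes> t" by (rule arg_cong)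
  then show ?thesis using assms(1-3) by simp
next
  case True
  with assms(4) have "len w < len (w \<otimes> t)" by simp
  with True show ?thesis by (rule folding_ascent[OF assms(1-3) _ _ assms(5)])
qed

text \<open>The elements w, s w, w t, s w t form a square whose sides change the length by exactly
  1. The coefficient vanishes unless both pairs of opposite corners have equal lengths, and then
  \<open>folding\<close> applies. Conversely, s w = w t makes s w t equal to \<open>w\<close>, and
  the coefficient is 2 (len w - len (w t)).\<close>

lemma gradient_coeff_gens:
  assumes "s \<in> X" "t \<in> X" "w \<in> carrier G"
  shows "gradient_coeff G len s t w \<noteq> 0 \<longleftrightarrow> s \<otimes> w = w \<otimes> t"
proof
  assume eq: "s \<otimes> w = w \<otimes> t"
  have "s \<otimes> w \<otimes> t = w" unfolding eq using assms by simp
  moreover have "len w \<noteq> len (w \<otimes> t)" using len_mult_gen_right[of t w] assms by auto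
  ultimately show "gradient_coeff G len s t w \<noteq> 0"
    unfolding gradient_coeff_def eq by simp
next
  assume nz: "gradient_coeff G len s t w \<noteq> 0"
  have "len (s \<otimes> w) = Suc (len w) \<or> len w = Suc (len (s \<otimes> w))"
    "len (w \<otimes> t) = Suc (len w) \<or> len w = Suc (len (w \<otimes> t))"
    "len (s \<otimes> w \<otimes> t) = Suc (len (s \<otimes> w)) \<or> len (s \<otimes> w) = Suc (len (s \<otimes> w \<otimes> t))"
    "len (s \<otimes> w \<otimes> t) = Suc (len (w \<otimes> t)) \<or> len (w \<otimes> t) = Suc (len (s \<otimes> w \<otimes> t))"
    using assms len_mult_gen_left[of s w] len_mult_gen_right[of t w]
      len_mult_gen_right[of t "s \<otimes> w"] len_mult_gen_left[of s "w \<otimes> t"] by (auto simp: m_assoc)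
  then have "len (s \<otimes> w) = len (w \<otimes> t)" "len (s \<otimes> w \<otimes> t) = len w"
    using nz unfolding gradient_coeff_def by arith+
  then show "s \<otimes> w = w \<otimes> t" by (rule folding[OF assms])
qed

lemma finite_gradient_support_iff:
  "(\<forall>s\<in>X. \<forall>t\<in>X. finite {w \<in> carrier G. w \<otimes> s = t \<otimes> w}) \<longleftrightarrow>
    (\<forall>u\<in>carrier G. \<forall>v\<in>carrier G. finite {w \<in> carrier G. gradient_coeff G len u v w \<noteq> 0})"
    (is "?L \<longleftrightarrow> ?R")
proof -
  have eq: "{w \<in> carrier G. gradient_coeff G len t s w \<noteq> 0} = {w \<in> carrier G. w \<otimes> s = t \<otimes> w}"
    if "s \<in> X" "t \<in> X" for s t
  proof (intro Collect_cong conj_cong refl)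
    fix w assume w: "w \<in> carrier G"
    show "gradient_coeff G len t s w \<noteq> 0 \<longleftrightarrow> w \<otimes> s = t \<otimes> w"
      unfolding gradient_coeff_gens[OF that(2,1) w] by (rule eq_commute)
  qed simp
  show ?thesis
  proof
    assume L: ?L
    show ?R
    proof (intro ballI)
      fix u v assume uv: "u \<in> carrier G" "v \<in> carrier G"
      show "finite {w \<in> carrier G. gradient_coeff G len u v w \<noteq> 0}"
      proof (rule finite_gradient_support[OF _ uv])
        fix s t assume st: "s \<in> X" "t \<in> X"
        show "finite {w \<in> carrier G. gradient_coeff G len s t w \<noteq> 0}"
          unfolding eq[OF st(2,1)] using L st by blast
      qed
    qed
  next
    assume R: ?R
    show ?L
    proof (intro ballI)
      fix s t assume st: "s \<in> X" "t \<in> X"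
      show "finite {w \<in> carrier G. w \<otimes> s = t \<otimes> w}"
        unfolding eq[OF st, symmetric] using R st gen_closed by blast
    qed
  qed
qed

text \<open>If m is shortest in its coset m W_J, then lengths add along the coset: deleting a letter of m
  would produce a shorter element of the coset.\<close>

lemma minimal_coset_factor:
  assumes J: "J \<subseteq> X" and m: "m \<in> carrier G"
    and min: "\<And>v. v \<in> lists J \<Longrightarrow> len m \<le> len (m \<otimes> prd G v)"
    and u: "u \<in> lists J"
  obtains u' where "u' \<in> lists J" "prd G u' = prd G u" "len (m \<otimes> prd G u) = len m + length u'"
proof -
  have JX: "v \<in> lists J \<Longrightarrow> v \<in> lists X" for v using lists_mono[OF J] by blast
  have "\<exists>u' \<in> lists J. prd G u' = prd G u \<and> len (m \<otimes> prd G u) = len m + length u'"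
    using u
  proof (induction u rule: rev_induct)
    case (snoc j u)
    then have j: "j \<in> J" "j \<in> X" "u \<in> lists J" using J by auto
    then obtain u' where u': "u' \<in> lists J" "prd G u' = prd G u"
      "len (m \<otimes> prd G u) = len m + length u'"
      using snoc.IH by auto
    note X = JX[OF j(3)] JX[OF u'(1)]
    have uj: "prd G (u @ [j]) = prd G u' \<otimes> j"
      using X j u' prd_append[of u "[j]"] by simp
    have mj: "m \<otimes> prd G (u @ [j]) = m \<otimes> prd G u' \<otimes> j"
      unfolding uj using X m j by (simp add: m_assoc)
    show ?case
    proof (cases "len (m \<otimes> prd G u) < len (m \<otimes> prd G u \<otimes> j)")
      case True
      then have "len (m \<otimes> prd G (u @ [j])) = len m + length (u' @ [j])"
        using len_mult_gen_right[of j "m \<otimes> prd G u"] X m j u' unfolding mj by auto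
      moreover have "prd G (u' @ [j]) = prd G (u @ [j])"
        unfolding uj using X j prd_append[of u' "[j]"] by simp
      ultimately show ?thesis using u'(1) j(1) by (intro bexI[of _ "u' @ [j]"]) auto
    next
      case False
      then have less: "len (m \<otimes> prd G u \<otimes> j) < len (m \<otimes> prd G u)"
        using len_mult_gen_right[of j "m \<otimes> prd G u"] X m j by auto
      obtain a where a: "a \<in> lists X" "prd G a = m" "length a = len m"
        using reduced_word m by blast
      have au: "prd G (a @ u') = m \<otimes> prd G u"
        using a X u' by (simp add: prd_append)
      obtain i where i: "i < length (a @ u')"
        "m \<otimes> prd G u \<otimes> j = prd G (take i (a @ u') @ drop (Suc i) (a @ u'))"
        using exchange_right[of "a @ u'" j] less j a X unfolding au by auto
      show ?thesis
      proof (cases "i < length a")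
        case True
        define b where "b = take i a @ drop (Suc i) a"
        have b: "b \<in> lists X" "length b < length a"
          using True a(1) by (auto simp: b_def in_lists_conv_set dest: in_set_takeD in_set_dropD)
        have "m \<otimes> prd G u' \<otimes> j = prd G (b @ u')"
          using i True u' by (simp add: b_def)
        then have "m \<otimes> prd G u' \<otimes> j = prd G b \<otimes> prd G u'"
          using b X by (simp add: prd_append)
        then have "prd G b = m \<otimes> prd G u' \<otimes> j \<otimes> inv (prd G u')"
          using b X m by (simp add: m_assoc)
        also have "\<dots> = m \<otimes> prd G (u' @ [j] @ rev u')"
          using X j m prd_append[of u' "[j] @ rev u'"] prd_append[of "[j]" "rev u'"] prd_rev[of u']
          by (simp add: m_assoc)
        finally have "len m \<le> len (prd G b)" using min[of "u' @ [j] @ rev u'"] u' j by simp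
        then show ?thesis using len_le[OF b(1)] b(2) a(3) by simp
      next
        case False
        define k where "k = i - length a"
        define u'' where "u'' = take k u' @ drop (Suc k) u'"
        have u'': "u'' \<in> lists J" "Suc (length u'') = length u'"
          using False i(1) u'(1)
          by (auto simp: u''_def k_def in_lists_conv_set dest: in_set_takeD in_set_dropD)
        have "m \<otimes> prd G u' \<otimes> j = prd G (a @ u'')"
          using i False u' by (simp add: u''_def k_def Suc_diff_le)
        also have "\<dots> = m \<otimes> prd G u''"
          using a JX[OF u''(1)] by (simp add: prd_append)
        finally have eq: "m \<otimes> prd G u' \<otimes> j = m \<otimes> prd G u''" .
        then have "prd G u' \<otimes> j = prd G u''"
          using m X j JX[OF u''(1)] by (simp add: m_assoc)
        moreover have "len (m \<otimes> prd G u' \<otimes> j) = len m + length u''"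
          using less len_mult_gen_right[of j "m \<otimes> prd G u"] X m j u' u'' by auto
        ultimately show ?thesis using u''(1) uj mj by (intro bexI[of _ u'']) auto
      qed
    qed
  qed (use m in auto)
  then show ?thesis using that by blast
qed

end

section \<open>Geodesic rays of elements intertwining two generators\<close>

context exchange_group
begin

text \<open>In terms of roots, \<open>w\<close> carries the simple root of \<open>q\<close> to that
  of \<open>t\<close>. Decompositions keep \<open>t\<close> fixed and change
  \<open>q\<close>.\<close>

definition rising :: "'g \<Rightarrow> 'g \<Rightarrow> 'g \<Rightarrow> bool" where
  "rising t w q \<longleftrightarrow> t \<in> X \<and> q \<in> X \<and> w \<in> carrier G \<and> w \<otimes> q = t \<otimes> w \<and> len w < len (w \<otimes> q)"

text \<open>For distinct \<open>r\<close> and \<open>s\<close> these are the elementary steps inside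
  their dihedral group: u s is reduced and conjugation by \<open>u\<close> turns \<open>s\<close>
  into \<open>q\<close>. If r s has finite order m, this forces u s to be the longest element, so
  that \<open>u\<close> has length m - 1; for infinite order there is no such
  \<open>u\<close>.\<close>

definition rising_steps :: "'g \<Rightarrow> 'g \<Rightarrow> 'g list set" where
  "rising_steps r s = {u \<in> lists {r, s}. u \<noteq> [] \<and> len (prd G (u @ [s])) = Suc (length u) \<and>
    (\<exists>q\<in>{r, s}. prd G (q # u) = prd G (u @ [s]))}"

lemma reduced_distinct_adj:
  assumes "xs \<in> lists X" "length xs \<le> len (prd G xs)"
  shows "distinct_adj xs"
proof (rule ccontr)
  assume "\<not> distinct_adj xs"
  then obtain i where i: "Suc i < length xs" "xs ! i = xs ! Suc i"
    by (auto simp: distinct_adj_conv_nth)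
  define as bs x where "as = take i xs" and "bs = drop (Suc (Suc i)) xs" and "x = xs ! i"
  have eq: "xs = as @ [x, x] @ bs"
    using i by (simp add: as_def bs_def x_def id_take_nth_drop[symmetric] Cons_nth_drop_Suc)
      (metis Cons_nth_drop_Suc Suc_lessD append_take_drop_id)
  have X: "as \<in> lists X" "x \<in> X" "bs \<in> lists X" using assms(1) unfolding eq by auto
  have "prd G xs = prd G (as @ bs)"
    unfolding eq using X by (simp add: prd_append)
  then have "len (prd G xs) \<le> length (as @ bs)" using X by (metis append_in_lists_conv len_le)
  then show False using assms(2) unfolding eq by simp
qed

text \<open>Reduced words in two involutions alternate. As u s is reduced, \<open>u\<close> ends in
  \<open>r\<close>; and q u, equally long and with the same product, is reduced as well.\<close>

lemma rising_steps_alternating: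
  assumes "u \<in> rising_steps r s" "r \<in> X" "s \<in> X" "r \<noteq> s"
  shows "u = alternating r s (length u)"
    and "\<exists>q\<in>{r, s}. q # u = alternating r s (Suc (length u)) \<and> prd G (q # u) = prd G (u @ [s])"
proof -
  have u: "u \<in> lists {r, s}" "u \<noteq> []" "len (prd G (u @ [s])) = Suc (length u)"
    using assms(1) by (auto simp: rising_steps_def)
  obtain q where q: "q \<in> {r, s}" "prd G (q # u) = prd G (u @ [s])"
    using assms(1) by (auto simp: rising_steps_def)
  have uX: "u \<in> lists X" "q \<in> X"
    using lists_mono[of "{r, s}" X] u(1) q(1) assms by auto
  have "distinct_adj (u @ [s])"
    by (rule reduced_distinct_adj) (use uX assms u(3) in auto)
  then have adj: "distinct_adj u" "last u \<noteq> s" using u(2) by (auto simp: distinct_adj_append_iff)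
  then have last: "last u = r" using u(1,2) last_in_set[of u] by (auto simp: in_lists_conv_set)
  show "u = alternating r s (length u)"
    by (rule alternating_eq) (use u(1) adj last in auto)
  have "distinct_adj (q # u)"
    by (rule reduced_distinct_adj) (use uX q(2) u(3) in auto)
  then have "q # u = alternating r s (length (q # u))"
    by (intro alternating_eq) (use u(1,2) q(1) last in auto)
  then have "q # u = alternating r s (Suc (length u))" by (simp only: list.size(4) add_0_right add_Suc_right)
  then show "\<exists>q\<in>{r, s}. q # u = alternating r s (Suc (length u)) \<and> prd G (q # u) = prd G (u @ [s])"
    using q by blast
qed

text \<open>A second, longer step u' would end in q u, so u' s = p q u s s for some p, shortening u' s.\<close>

lemma finite_rising_steps:
  assumes "r \<in> X" "s \<in> X" "r \<noteq> s"
  shows "finite (rising_steps r s)"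
proof -
  have le: "length u' \<le> length u" if u: "u \<in> rising_steps r s" and u': "u' \<in> rising_steps r s" for u u'
  proof (rule ccontr)
    assume "\<not> ?thesis"
    then have less: "Suc (length u) \<le> length u'" by simp
    obtain q where q: "q \<in> {r, s}" "q # u = alternating r s (Suc (length u))"
      "prd G (q # u) = prd G (u @ [s])"
      using rising_steps_alternating(2)[OF u assms] by blast
    obtain p where p: "u' = p @ q # u"
      using alternating_suffix[OF less, of r s] rising_steps_alternating(1)[OF u' assms] q(2) by metis
    have "u' \<in> lists {r, s}" "len (prd G (u' @ [s])) = Suc (length u')"
      using u' by (auto simp: rising_steps_def)
    then have uX: "u' \<in> lists X" "u \<in> lists X" "p \<in> lists X" "q \<in> X"
      using lists_mono[of "{r, s}" X] assms p by auto
    have "prd G (u' @ [s]) = prd G p \<otimes> (prd G (q # u) \<otimes> s)"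
      using uX assms prd_append[of p "(q # u) @ [s]"] prd_append[of "q # u" "[s]"] unfolding p by simp
    also have "\<dots> = prd G p \<otimes> prd G u"
      unfolding q(3) using uX assms prd_append[of u "[s]"] by simp
    also have "\<dots> = prd G (p @ u)" using uX by (simp add: prd_append)
    finally have "len (prd G (u' @ [s])) \<le> length (p @ u)"
      using uX len_le[of "p @ u"] by simp
    then show False using \<open>len (prd G (u' @ [s])) = Suc (length u')\<close> p by simp
  qed
  show ?thesis
  proof (rule finite_if_all_eq)
    fix u u' assume "u \<in> rising_steps r s" "u' \<in> rising_steps r s"
    then show "u = u'"
      using le rising_steps_alternating(1)[OF _ assms] by (metis le_antisym)
  qed
qed

text \<open>The last letter \<open>r\<close> of a reduced word of \<open>w\<close> differs from
  \<open>s\<close>, because \<open>s\<close> lengthens \<open>w\<close>. Let m be shortest in the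
  coset of \<open>w\<close> modulo the subgroup of \<open>r\<close> and \<open>s\<close>, and w = m
  u. Then t m = m (u s u^-1) lies in that coset as well, so its length exceeds that of m by the
  length of a word in \<open>r\<close> and \<open>s\<close>. Since \<open>t\<close> changes lengths
  by exactly 1, this word is a single generator \<open>q\<close>: thus m is rising, and cancelling m
  shows q u = u s.\<close>

lemma rising_decompose:
  assumes w: "rising t w s" and "w \<noteq> \<one>"
  obtains w' q r u where "rising t w' q" "r \<in> X" "r \<noteq> s" "u \<in> rising_steps r s"
    "w = w' \<otimes> prd G u" "len w = len w' + length u"
proof -
  have [simp]: "w \<in> carrier G" "t \<in> X" "s \<in> X" and ws: "w \<otimes> s = t \<otimes> w" "len w < len (w \<otimes> s)"
    using w by (auto simp: rising_def)
  obtain xs where xs: "xs \<in> lists X" "prd G xs = w" "length xs = len w"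
    using reduced_word[of w] by auto
  then obtain ys r where yr: "xs = ys @ [r]" "ys \<in> lists X" and r [simp]: "r \<in> X"
    using \<open>w \<noteq> \<one>\<close> by (cases xs rule: rev_cases) auto
  have "w \<otimes> r = prd G ys" using xs(2) yr by (auto simp: prd_append)
  then have wr: "len (w \<otimes> r) < len w" using len_le[OF yr(2)] xs(3) yr(1) by simp
  then have "r \<noteq> s" using ws(2) by auto
  let ?J = "{r, s}"
  have J: "?J \<subseteq> X" by simp
  have JX: "v \<in> lists ?J \<Longrightarrow> v \<in> lists X" for v using lists_mono[OF J] by blast
  define n where "n = (LEAST n. \<exists>v\<in>lists ?J. len (w \<otimes> prd G v) = n)"
  have "\<exists>v\<in>lists ?J. len (w \<otimes> prd G v) = n"
    unfolding n_def by (rule LeastI_ex) auto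
  then obtain v where v: "v \<in> lists ?J" "len (w \<otimes> prd G v) = n" by blast
  define m where "m = w \<otimes> prd G v"
  have m [simp]: "m \<in> carrier G" using JX[OF v(1)] by (simp add: m_def)
  have n_le: "n \<le> len (w \<otimes> prd G v')" if "v' \<in> lists ?J" for v'
    unfolding n_def by (rule Least_le) (use that in blast)
  have min: "len m \<le> len (m \<otimes> prd G v')" if "v' \<in> lists ?J" for v'
    using n_le[of "v @ v'"] v that JX[OF that] JX[OF v(1)]
    by (simp add: m_def m_assoc prd_append)
  have w_m: "w = m \<otimes> prd G (rev v)"
    using JX[OF v(1)] by (simp add: m_def m_assoc prd_rev)
  obtain u where u: "u \<in> lists ?J" "prd G u = prd G (rev v)" "len w = len m + length u"
    using minimal_coset_factor[OF J m min, of "rev v"] v(1) unfolding w_m[symmetric] by auto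
  have wu: "w = m \<otimes> prd G u" using u(2) w_m by simp
  have uX: "u \<in> lists X" using JX u(1) by blast
  \<comment> \<open>The descent \<open>r\<close> of \<open>w\<close> belongs to the coset subgroup,
    so \<open>w\<close> itself is not minimal; the factor \<open>u\<close> is nonempty and the
    remaining element is strictly shorter.\<close>
  have "len m < len w" using n_le[of "[r]"] wr v(2) by (simp add: m_def)
  then have "u \<noteq> []" using u(3) by auto
  have "t \<otimes> m = t \<otimes> w \<otimes> inv (prd G u)" using uX by (simp add: wu m_assoc)
  also have "\<dots> = m \<otimes> prd G (u @ [s] @ rev u)"
    unfolding ws(1)[symmetric] using uX prd_append[of u "[s] @ rev u"] prd_append[of "[s]" "rev u"] prd_rev[OF uX]
    by (simp add: wu m_assoc)
  finally have tm: "t \<otimes> m = m \<otimes> prd G (u @ [s] @ rev u)" .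
  obtain qs where qs: "qs \<in> lists ?J" "prd G qs = prd G (u @ [s] @ rev u)"
    "len (t \<otimes> m) = len m + length qs"
    using minimal_coset_factor[OF J m min, of "u @ [s] @ rev u"] u(1) unfolding tm by auto
  then have "length qs = 1" using len_mult_gen_left[of t m] by auto
  then obtain q where q: "qs = [q]" "q \<in> ?J" using qs(1) by (auto simp: length_Suc_conv)
  have qX [simp]: "q \<in> X" using q(2) by auto
  have mq: "m \<otimes> q = t \<otimes> m" using tm qs(2) q by simp
  have "m \<otimes> prd G (q # u) = m \<otimes> q \<otimes> prd G u" using uX by (simp add: m_assoc)
  also have "\<dots> = w \<otimes> s" unfolding mq ws(1) using uX by (simp add: wu m_assoc)
  also have "\<dots> = m \<otimes> prd G (u @ [s])" using uX by (simp add: wu m_assoc prd_append)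
  finally have "m \<otimes> prd G (q # u) = m \<otimes> prd G (u @ [s])" .
  then have eq: "prd G (q # u) = prd G (u @ [s])" using uX by (simp add: prd_append)
  have "m \<otimes> prd G (u @ [s]) = w \<otimes> s" using uX by (simp add: wu m_assoc prd_append)
  then have "len w < len m + len (prd G (u @ [s]))"
    using ws(2) len_mult[of m "prd G (u @ [s])"] uX by simp
  then have "len (prd G (u @ [s])) = Suc (length u)"
    using len_le[of "u @ [s]"] uX u(3) by simp
  then have "u \<in> rising_steps r s"
    unfolding rising_steps_def using u(1) \<open>u \<noteq> []\<close> q(2) eq by auto
  moreover have "rising t m q"
    unfolding rising_def using mq qs(3) q(1) by simp
  ultimately show ?thesis using that \<open>r \<noteq> s\<close> wu u(3) r by blast
qed

text \<open>Vertices are words rather than group elements, so that the steps of a branch prolong one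
  word and its prefixes trace a geodesic. The conditions on \<open>L @ u\<close> admit only reduced
  words of rising elements.\<close>

definition rising_word_step :: "'g \<Rightarrow> ('g list \<times> 'g list) set" where
  "rising_word_step t = {(L, L @ u) | L u. L \<in> lists X \<and>
    (\<exists>r\<in>X. \<exists>s\<in>X. r \<noteq> s \<and> u \<in> rising_steps r s) \<and>
    (\<exists>q. rising t (prd G (L @ u)) q) \<and> len (prd G (L @ u)) = length (L @ u)}"

lemma rising_word_reachable:
  assumes "rising t w s"
  shows "\<exists>L \<in> lists X. ([], L) \<in> (rising_word_step t)\<^sup>* \<and> prd G L = w \<and> length L = len w"
  using assms
proof (induction "len w" arbitrary: w s rule: less_induct)
  case less
  show ?case
  proof (cases "w = \<one>")
    case True
    then show ?thesis by (intro bexI[of _ "[]"]) auto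
  next
    case False
    obtain w' q r u where *: "rising t w' q" "r \<in> X" "r \<noteq> s" "u \<in> rising_steps r s"
      "w = w' \<otimes> prd G u" "len w = len w' + length u"
      using rising_decompose[OF less.prems False] by metis
    have u: "u \<in> lists {r, s}" "u \<noteq> []" "s \<in> X"
      using *(4) less.prems by (auto simp: rising_steps_def rising_def)
    then have uX: "u \<in> lists X" using lists_mono[of "{r, s}" X] *(2) by auto
    have "len w' < len w" using *(6) u(2) by simp
    then obtain L where L: "L \<in> lists X" "([], L) \<in> (rising_word_step t)\<^sup>*" "prd G L = w'"
      "length L = len w'"
      using less.hyps *(1) by blast
    have "prd G (L @ u) = w" using L uX *(5) by (simp add: prd_append)
    then have "(L, L @ u) \<in> rising_word_step t"
      unfolding rising_word_step_def using L uX u(3) * less.prems by auto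
    then show ?thesis
      using L uX *(6) \<open>prd G (L @ u) = w\<close> by (intro bexI[of _ "L @ u"]) auto
  qed
qed

lemma len_take_reduced:
  assumes "L \<in> lists X" "len (prd G L) = length L" "n \<le> length L"
  shows "len (prd G (take n L)) = n"
proof -
  have X: "take n L \<in> lists X" "drop n L \<in> lists X"
    using assms(1) by (auto simp: in_lists_conv_set dest: in_set_takeD in_set_dropD)
  have "len (prd G L) \<le> len (prd G (take n L)) + length (drop n L)"
    using len_mult[of "prd G (take n L)" "prd G (drop n L)"] prd_append[OF X] len_le[OF X(2)] X
    by simp
  then show ?thesis using len_le[OF X(1)] assms by simp
qed

lemma rising_geodesic:
  assumes inf: "infinite {w. \<exists>q. rising t w q}"
  obtains \<alpha> k q where "inf_geodesic G X \<alpha>" "filterlim k at_top sequentially"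
    "\<And>i::nat. rising t (\<alpha> (k i)) (q i)"
proof -
  let ?step = "rising_word_step t"
  have "{w. \<exists>q. rising t w q} \<subseteq> prd G ` (?step\<^sup>* `` {[]})"
    using rising_word_reachable by (force simp: image_iff)
  then have "infinite (?step\<^sup>* `` {[]})" using inf finite_subset by blast
  moreover have "finite (?step `` {L})" for L
  proof (rule finite_subset)
    show "?step `` {L} \<subseteq> (\<lambda>u. L @ u) ` (\<Union>r\<in>X. \<Union>s\<in>X - {r}. rising_steps r s)"
      by (auto simp: rising_word_step_def)
    show "finite ((\<lambda>u. L @ u) ` (\<Union>r\<in>X. \<Union>s\<in>X - {r}. rising_steps r s))"
      by (intro finite_imageI finite_UN_I finite_gens finite_Diff finite_rising_steps) auto
  qed
  ultimately have "\<exists>L. L 0 = [] \<and> (\<forall>n. (L n, L (Suc n)) \<in> ?step)"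
    by (rule koenig_rtrancl) blast
  then obtain L where L: "L 0 = []" "\<And>n::nat. (L n, L (Suc n)) \<in> ?step" by blast
  have ext: "\<exists>u. u \<noteq> [] \<and> L (Suc n) = L n @ u" for n
    using L(2)[of n] unfolding rising_word_step_def rising_steps_def by auto
  have LX: "L n \<in> lists X" for n
    using L(2)[of n] unfolding rising_word_step_def by auto
  have red: "len (prd G (L n)) = length (L n)" for n
    using L(1) L(2)[of "n - 1"] unfolding rising_word_step_def by (cases n) auto
  have "\<exists>q. rising t (prd G (L (Suc n))) q" for n
    using L(2)[of n] unfolding rising_word_step_def by auto
  then obtain q where q: "\<And>n. rising t (prd G (L (Suc n))) (q n)" by metis
  have len_L: "n \<le> length (L n)" for n
  proof (induction n)
    case (Suc n)
    obtain u where "u \<noteq> []" "L (Suc n) = L n @ u" using ext by blast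
    then show ?case using Suc by (cases u) auto
  qed simp
  have prefix: "\<exists>u. L (m + d) = L m @ u" for m d
  proof (induction d)
    case (Suc d)
    then show ?case using ext[of "m + d"] by auto
  qed simp
  \<comment> \<open>The words \<open>L n\<close> are prefixes of one infinite word, and
    \<open>\<alpha> n\<close> is the product of its first n letters. These are available in
    \<open>L n\<close>, since each step adds at least one letter.\<close>
  define \<alpha> where "\<alpha> n = prd G (take n (L n))" for n
  have \<alpha>: "\<alpha> k = prd G (take k (L n))" if "k \<le> length (L n)" for k n
  proof -
    have "take k (L n) = take k (L k)"
    proof (cases "k \<le> n")
      case True
      then obtain u where "L n = L k @ u" using prefix[of k "n - k"] by auto
      then show ?thesis using len_L[of k] by simp
    next
      case False
      then obtain u where "L k = L n @ u" using prefix[of n "k - n"] by auto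
      then show ?thesis using that by simp
    qed
    then show ?thesis by (simp add: \<alpha>_def)
  qed
  have geo: "inf_geodesic G X \<alpha>"
    unfolding inf_geodesic_iff
  proof (intro conjI allI)
    show "\<alpha> 0 \<in> carrier G" by (simp add: \<alpha>_def)
    fix n
    have n: "n < length (L (Suc n))" using len_L[of "Suc n"] by simp
    have "\<alpha> (Suc n) = prd G (take n (L (Suc n)) @ [L (Suc n) ! n])"
      using \<alpha>[of "Suc n" "Suc n"] n by (simp add: take_Suc_conv_app_nth)
    moreover have "take n (L (Suc n)) \<in> lists X" "L (Suc n) ! n \<in> X"
      using LX[of "Suc n"] n by (auto simp: in_lists_conv_set dest: in_set_takeD)
    ultimately show "\<exists>s\<in>X. \<alpha> (Suc n) = \<alpha> n \<otimes> s"
      using \<alpha>[of n "Suc n"] n by (intro bexI[of _ "L (Suc n) ! n"]) (auto simp: prd_append)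
    have "take n (L n) \<in> lists X"
      using LX[of n] by (auto simp: in_lists_conv_set dest: in_set_takeD)
    then show "len (inv (\<alpha> 0) \<otimes> \<alpha> n) = n"
      using len_take_reduced[OF LX red len_L, of n] by (simp add: \<alpha>_def)
  qed
  show ?thesis
  proof (rule that[OF geo])
    have "k \<le> length (L (Suc k))" for k using len_L[of "Suc k"] by simp
    \<comment> \<open>A step guarantees \<open>rising\<close> only for the longer of its two words,
      so the ray is sampled from \<open>L (Suc 0)\<close> on.\<close>
    then show "filterlim (\<lambda>i. length (L (Suc i))) at_top sequentially"
      by (intro filterlim_at_top_mono[OF filterlim_ident]) (auto intro: always_eventually)
    show "rising t (\<alpha> (length (L (Suc i)))) (q i)" for i
      using q[of i] \<alpha>[of "length (L (Suc i))" "Suc i"] by simp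
  qed
qed

text \<open>Along the ray \<open>\<alpha>\<close> of elements v with v q = t v > v, the generator t is never below v but always
  below v q, so that right multiplication by some q moves the boundary point.\<close>

lemma finite_rising_if_small:
  assumes small: "small_at_infinity G X" and t: "t \<in> X"
  shows "finite {w. \<exists>q. rising t w q}"
proof (rule ccontr)
  assume "\<not> ?thesis"
  then obtain \<alpha> k q where geo: "inf_geodesic G X \<alpha>" and k: "filterlim k at_top sequentially"
    and rise: "\<And>i::nat. rising t (\<alpha> (k i)) (q i)"
    using rising_geodesic by metis
  obtain z where z: "z \<in> boundary G X" "\<alpha> \<in> z" using inf_geodesic_boundary[OF geo] by blast
  define v where "v i = \<alpha> (k i)" for i
  have v [simp]: "v i \<in> carrier G" for i by (simp add: v_def inf_geodesic_closed[OF geo])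
  have lim: "\<forall>\<^sub>F i in sequentially. weak_le G X w (v i) \<longleftrightarrow> weak_le_inf G X w \<alpha>"
    if "w \<in> carrier G" for w
    unfolding v_def by (rule eventually_compose_filterlim[OF weak_le_inf_dichotomy[OF geo that] k])
  have lim_v: "limitin (compactification_topology G X) (\<lambda>i. Inl (v i)) (Inr z) sequentially"
    using limitin_boundary_iff[OF z, of v] lim by simp
  have "\<forall>\<^sub>F i in sequentially. weak_le G X t (v i \<otimes> s) \<longleftrightarrow> weak_le_inf G X t \<alpha>" if "s \<in> X" for s
  proof -
    have "limitin (compactification_topology G X) (\<lambda>i. Inl (v i \<otimes> s)) (Inr z) sequentially"
      using small z(1) lim_v gen_closed[OF that] v unfolding small_at_infinity_def by blast
    then show ?thesis
      using limitin_boundary_iff[OF z, of "\<lambda>i. v i \<otimes> s"] that t by simp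
  qed
  \<comment> \<open>The generator \<open>q i\<close> varies with i, so an index is needed that is
    good for all of \<open>X\<close> at once.\<close>
  then have "\<forall>\<^sub>F i in sequentially. \<forall>s\<in>X. weak_le G X t (v i \<otimes> s) \<longleftrightarrow> weak_le_inf G X t \<alpha>"
    by (intro eventually_ball_finite[OF finite_gens] ballI)
  then have "\<forall>\<^sub>F i in sequentially. (\<forall>s\<in>X. weak_le G X t (v i \<otimes> s) \<longleftrightarrow> weak_le_inf G X t \<alpha>) \<and>
      (weak_le G X t (v i) \<longleftrightarrow> weak_le_inf G X t \<alpha>)"
    using lim[OF gen_closed[OF t]] by (rule eventually_conj)
  then obtain i where i: "\<forall>s\<in>X. weak_le G X t (v i \<otimes> s) \<longleftrightarrow> weak_le_inf G X t \<alpha>"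
    "weak_le G X t (v i) \<longleftrightarrow> weak_le_inf G X t \<alpha>"
    using eventually_happens'[OF sequentially_bot] by blast
  have r: "q i \<in> X" "v i \<otimes> q i = t \<otimes> v i" "len (v i) < len (t \<otimes> v i)"
    using rise[of i] by (auto simp: rising_def v_def)
  have "weak_le G X t (v i \<otimes> q i)"
    using r t len_gen_le[OF t] len_mult[of t "v i"] unfolding weak_le_iff by simp
  moreover have "\<not> weak_le G X t (v i)"
    using r t unfolding weak_le_iff by simp
  ultimately show False using i r(1) by blast
qed

text \<open>If \<open>s\<close> shortens an intertwiner \<open>w\<close>, then
  \<open>w \<otimes> s\<close> is rising and a second factor \<open>s\<close> restores
  \<open>w\<close>. So the rising elements and their right translates by \<open>s\<close> cover the
  set.\<close>

lemma finite_intertwiners_if_small: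
  assumes "small_at_infinity G X" "s \<in> X" "t \<in> X"
  shows "finite {w \<in> carrier G. w \<otimes> s = t \<otimes> w}"
proof (rule finite_subset)
  let ?B = "{w. \<exists>q. rising t w q}"
  show "{w \<in> carrier G. w \<otimes> s = t \<otimes> w} \<subseteq> ?B \<union> (\<lambda>w. w \<otimes> s) ` ?B"
  proof
    fix w assume "w \<in> {w \<in> carrier G. w \<otimes> s = t \<otimes> w}"
    then have w: "w \<in> carrier G" "w \<otimes> s = t \<otimes> w" by auto
    show "w \<in> ?B \<union> (\<lambda>w. w \<otimes> s) ` ?B"
    proof (cases "len w < len (w \<otimes> s)")
      case True
      then have "rising t w s" using assms w unfolding rising_def by blast
      then show ?thesis by blast
    next
      case False
      then have less: "len (w \<otimes> s) < len w" using len_mult_gen_right[of s w] assms w by auto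
      have wss: "w \<otimes> s \<otimes> s = w" using assms w(1) by simp
      have "t \<otimes> (w \<otimes> s) = w" unfolding w(2) using assms w(1) by simp
      then have "rising t (w \<otimes> s) s" unfolding rising_def wss using assms w(1) less by simp
      then show ?thesis using wss by (metis (mono_tags, lifting) UnI2 image_eqI mem_Collect_eq)
    qed
  qed
  show "finite (?B \<union> (\<lambda>w. w \<otimes> s) ` ?B)" using finite_rising_if_small assms by simp
qed

lemma small_at_infinity_iff:
  "small_at_infinity G X \<longleftrightarrow> (\<forall>s\<in>X. \<forall>t\<in>X. finite {w \<in> carrier G. w \<otimes> s = t \<otimes> w})"
proof
  assume "small_at_infinity G X"
  then show "\<forall>s\<in>X. \<forall>t\<in>X. finite {w \<in> carrier G. w \<otimes> s = t \<otimes> w}"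
    using finite_intertwiners_if_small by blast
next
  assume "\<forall>s\<in>X. \<forall>t\<in>X. finite {w \<in> carrier G. w \<otimes> s = t \<otimes> w}"
  then show "small_at_infinity G X"
    unfolding finite_gradient_support_iff
    using small_at_infinity_if_finite_support[OF finite_gens] by blast
qed

end

section \<open>Finite rank operators\<close>

lemma sum_fun_apply: "(\<Sum>v\<in>t. f v) x = (\<Sum>v\<in>t. f v x)"
  by (induction t rule: infinite_finite_induct) auto

lemma ell2_finite_support:
  assumes "finite K" "K \<subseteq> A" "\<And>x. x \<notin> K \<Longrightarrow> f x = 0"
  shows "f \<in> ell2 A" "ell2_norm A f = sqrt (\<Sum>x\<in>K. (cmod (f x))\<^sup>2)"
proof -
  have "(\<lambda>x. (cmod (f x))\<^sup>2) summable_on A \<longleftrightarrow> (\<lambda>x. (cmod (f x))\<^sup>2) summable_on K"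
    by (rule summable_on_cong_neutral) (use assms in auto)
  then show "f \<in> ell2 A" using assms by (auto simp: ell2_def)
  have "(\<Sum>\<^sub>\<infinity>x\<in>A. (cmod (f x))\<^sup>2) = (\<Sum>\<^sub>\<infinity>x\<in>K. (cmod (f x))\<^sup>2)"
    by (rule infsum_cong_neutral) (use assms in auto)
  then show "ell2_norm A f = sqrt (\<Sum>x\<in>K. (cmod (f x))\<^sup>2)"
    using assms by (simp add: ell2_norm_def)
qed

lemma ell2_diff:
  assumes "f \<in> ell2 A" "g \<in> ell2 A"
  shows "f - g \<in> ell2 A"
proof -
  have "(\<lambda>x. 2 * (cmod (f x))\<^sup>2 + 2 * (cmod (g x))\<^sup>2) summable_on A"
    using assms by (intro summable_on_add summable_on_cmult_right) (auto simp: ell2_def)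
  moreover have "(cmod (f x - g x))\<^sup>2 \<le> 2 * (cmod (f x))\<^sup>2 + 2 * (cmod (g x))\<^sup>2" for x
  proof -
    have "(cmod (f x - g x))\<^sup>2 \<le> (cmod (f x) + cmod (g x))\<^sup>2"
      by (intro power_mono norm_triangle_ineq4) auto
    also have "\<dots> \<le> 2 * (cmod (f x))\<^sup>2 + 2 * (cmod (g x))\<^sup>2"
      using sum_squares_bound[of "cmod (f x)" "cmod (g x)"] by (simp add: power2_sum)
    finally show ?thesis .
  qed
  ultimately have "(\<lambda>x. (cmod (f x - g x))\<^sup>2) summable_on A"
    by (rule summable_on_comparison_test) auto
  then show ?thesis using assms by (auto simp: ell2_def)
qed

lemma ell2_norm_coord:
  assumes "f \<in> ell2 A"
  shows "cmod (f x) \<le> ell2_norm A f"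
proof (cases "x \<in> A")
  case True
  have "(\<Sum>y\<in>{x}. (cmod (f y))\<^sup>2) \<le> (\<Sum>\<^sub>\<infinity>y\<in>A. (cmod (f y))\<^sup>2)"
    by (rule finite_sum_le_infsum) (use assms True in \<open>auto simp: ell2_def\<close>)
  then show ?thesis unfolding ell2_norm_def by (intro real_le_rsqrt) simp
next
  case False
  then show ?thesis using assms by (auto simp: ell2_def ell2_norm_def infsum_nonneg)
qed

lemma ell2_inner_finite_support:
  assumes "finite K" "K \<subseteq> A" "\<And>x. x \<notin> K \<Longrightarrow> f x = 0 \<or> g x = 0"
  shows "ell2_inner A f g = (\<Sum>x\<in>K. f x * cnj (g x))"
proof -
  have "(\<Sum>\<^sub>\<infinity>x\<in>A. f x * cnj (g x)) = (\<Sum>\<^sub>\<infinity>x\<in>K. f x * cnj (g x))"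
    by (rule infsum_cong_neutral) (use assms in auto)
  then show ?thesis using assms by (simp add: ell2_inner_def)
qed

text \<open>In other words, distinct basis vectors tend weakly to 0.\<close>

lemma ell2_tendsto_0_along:
  fixes y :: "nat \<Rightarrow> 'a"
  assumes "g \<in> ell2 A" "inj y" "range y \<subseteq> A"
  shows "(\<lambda>n. cmod (g (y n))) \<longlonglongrightarrow> 0"
proof -
  have "(\<lambda>x. (cmod (g x))\<^sup>2) summable_on range y"
    by (rule summable_on_subset_banach[of _ A]) (use assms in \<open>auto simp: ell2_def\<close>)
  then have "(\<lambda>n. (cmod (g (y n)))\<^sup>2) summable_on UNIV"
    using assms(2) by (simp add: summable_on_reindex o_def)
  then have "summable (\<lambda>n. (cmod (g (y n)))\<^sup>2)"
    by (subst (asm) summable_on_UNIV_nonneg_real_iff) auto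
  then have "(\<lambda>n. (cmod (g (y n)))\<^sup>2) \<longlonglongrightarrow> 0" by (rule summable_LIMSEQ_zero)
  then have "(\<lambda>n. sqrt ((cmod (g (y n)))\<^sup>2)) \<longlonglongrightarrow> sqrt 0" by (rule tendsto_real_sqrt)
  then show ?thesis by simp
qed

lemma bounded_coords_subseq:
  fixes f :: "nat \<Rightarrow> 'a \<Rightarrow> complex"
  assumes "finite F" "\<And>n w. w \<in> F \<Longrightarrow> cmod (f n w) \<le> B"
  shows "\<exists>r l. strict_mono (r :: nat \<Rightarrow> nat) \<and> (\<forall>w\<in>F. (\<lambda>n. f (r n) w) \<longlonglongrightarrow> l w)"
  using assms
proof (induction F)
  case empty
  then show ?case by (intro exI[of _ id]) (auto simp: strict_mono_def)
next
  case (insert x F)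
  then obtain r l where r: "strict_mono r" "\<forall>w\<in>F. (\<lambda>n. f (r n) w) \<longlonglongrightarrow> l w"
    by auto
  have "bounded (range (\<lambda>n. f (r n) x))" using insert.prems by (intro boundedI[of _ B]) auto
  then obtain c q where q: "strict_mono (q :: nat \<Rightarrow> nat)" "((\<lambda>n. f (r n) x) \<circ> q) \<longlonglongrightarrow> c"
    using bounded_imp_convergent_subsequence by blast
  have "(\<lambda>n. f ((r \<circ> q) n) w) \<longlonglongrightarrow> (l(x := c)) w" if "w \<in> insert x F" for w
    using that q(2) r(2) LIMSEQ_subseq_LIMSEQ[OF _ q(1), of "\<lambda>n. f (r n) w" "l w"]
    by (auto simp: o_def)
  then show ?case using strict_mono_o[OF r(1) q(1)] by blast
qed

text \<open>A matrix with columns \<open>F\<close> and rows \<open>K\<close>, two sets kept apart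
  because gradient maps move supports. The aim is that such an operator lies in every Schatten
  class.\<close>

locale finite_kernel =
  fixes A :: "'a set" and F K :: "'a set" and k :: "'a \<Rightarrow> 'a \<Rightarrow> complex"
    and T :: "('a \<Rightarrow> complex) \<Rightarrow> 'a \<Rightarrow> complex"
  assumes F: "finite F" "F \<subseteq> A" and K: "finite K" "K \<subseteq> A"
    and T: "\<And>f z. T f z = (if z \<in> K then \<Sum>w\<in>F. k z w * f w else 0)"
begin

lemma T_ell2: "T f \<in> ell2 A"
  using ell2_finite_support(1)[OF K, of "T f"] T by auto

lemma T_norm: "ell2_norm A (T f) = sqrt (\<Sum>z\<in>K. (cmod (T f z))\<^sup>2)"
  using ell2_finite_support(2)[OF K, of "T f"] T by auto

lemma T_bounded: "T \<in> bounded_ops A"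
proof -
  have "T (f + g) = T f + T g" for f g
    by (auto simp: T fun_eq_iff distrib_left sum.distrib)
  moreover have "T (fscale c f) = fscale c (T f)" for c f
    by (auto simp: T fun_eq_iff fscale_def sum_distrib_left algebra_simps)
  moreover have "ell2_norm A (T f) \<le> (\<Sum>z\<in>K. \<Sum>w\<in>F. cmod (k z w)) * ell2_norm A f"
    if f: "f \<in> ell2 A" for f
  proof -
    have "ell2_norm A (T f) = L2_set (\<lambda>z. cmod (T f z)) K" by (simp add: T_norm L2_set_def)
    also have "\<dots> \<le> (\<Sum>z\<in>K. cmod (T f z))" by (intro L2_set_le_sum) auto
    also have "\<dots> \<le> (\<Sum>z\<in>K. \<Sum>w\<in>F. cmod (k z w) * ell2_norm A f)"
    proof (rule sum_mono)
      fix z assume "z \<in> K"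
      then have "cmod (T f z) \<le> (\<Sum>w\<in>F. cmod (k z w * f w))" by (simp add: T norm_sum)
      also have "\<dots> \<le> (\<Sum>w\<in>F. cmod (k z w) * ell2_norm A f)"
        by (intro sum_mono) (simp add: norm_mult ell2_norm_coord[OF f] mult_left_mono)
      finally show "cmod (T f z) \<le> (\<Sum>w\<in>F. cmod (k z w) * ell2_norm A f)" .
    qed
    also have "\<dots> = (\<Sum>z\<in>K. \<Sum>w\<in>F. cmod (k z w)) * ell2_norm A f"
      by (simp add: sum_distrib_right)
    finally show ?thesis .
  qed
  ultimately show ?thesis unfolding bounded_ops_def using T_ell2 by blast
qed

lemma T_compact: "T \<in> compact_ops A"
proof -
  have "\<exists>g\<in>ell2 A. \<exists>r. strict_mono r \<and> (\<lambda>n. ell2_norm A (T (f (r n)) - g)) \<longlonglongrightarrow> 0"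
    if f: "\<And>n. f n \<in> ell2 A" "\<And>n. ell2_norm A (f n) \<le> B" for f :: "nat \<Rightarrow> 'a \<Rightarrow> complex" and B
  proof -
    have "cmod (f n w) \<le> B" for n w
      using ell2_norm_coord[OF f(1)] f(2) by (meson order_trans)
    then obtain r l where r: "strict_mono (r :: nat \<Rightarrow> nat)" "\<forall>w\<in>F. (\<lambda>n. f (r n) w) \<longlonglongrightarrow> l w"
      using bounded_coords_subseq[OF F(1)] by metis
    \<comment> \<open>\<open>T\<close> reads only the coordinates in \<open>F\<close>, so the values
      of \<open>l\<close> elsewhere, which are arbitrary, do no harm; the limit in
      \<open>ell2\<close> will be \<open>T l\<close>, not \<open>l\<close>.\<close>
    have "(\<lambda>n. T (f (r n)) z) \<longlonglongrightarrow> T l z" for z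
      unfolding T using r(2) by (auto intro!: tendsto_intros)
    then have "(\<lambda>n. T (f (r n)) z - T l z) \<longlonglongrightarrow> 0" for z by (simp add: LIM_zero)
    then have "(\<lambda>n. cmod (T (f (r n)) z - T l z)) \<longlonglongrightarrow> 0" for z by (rule tendsto_norm_zero)
    then have "(\<lambda>n. sqrt (\<Sum>z\<in>K. (cmod (T (f (r n)) z - T l z))\<^sup>2)) \<longlonglongrightarrow> sqrt (\<Sum>z\<in>K. 0\<^sup>2)"
      by (intro tendsto_intros)
    moreover have "ell2_norm A (T (f (r n)) - T l) = sqrt (\<Sum>z\<in>K. (cmod (T (f (r n)) z - T l z))\<^sup>2)" for n
      using ell2_finite_support(2)[OF K, of "T (f (r n)) - T l"] T by auto
    ultimately have "(\<lambda>n. ell2_norm A (T (f (r n)) - T l)) \<longlonglongrightarrow> 0" by simp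
    then show ?thesis using r(1) T_ell2 by blast
  qed
  then show ?thesis unfolding compact_ops_def using T_bounded by blast
qed

text \<open>Testing the eigenvalue equation against \<open>delta w\<close>, which \<open>T\<close>
  kills, gives s^2 v(w) = 0.\<close>

lemma singular_space_support:
  assumes "v \<in> singular_space A T s" "s > 0" "w \<notin> F"
  shows "v w = 0"
proof (cases "w \<in> A")
  case True
  have Td: "T (delta w) z = 0" for z
    using \<open>w \<notin> F\<close> unfolding T delta_def by (auto intro!: sum.neutral)
  have "delta w \<in> ell2 A" by (rule ell2_finite_support(1)[of "{w}"]) (use True in \<open>auto simp: delta_def\<close>)
  then have "ell2_inner A (T v) (T (delta w)) = of_real (s\<^sup>2) * ell2_inner A v (delta w)"
    using assms(1) by (auto simp: singular_space_def)
  moreover have "ell2_inner A (T v) (T (delta w)) = 0" by (simp add: ell2_inner_def Td)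
  moreover have "ell2_inner A v (delta w) = v w"
    using ell2_inner_finite_support[of "{w}" A v "delta w"] True by (auto simp: delta_def)
  ultimately show ?thesis using \<open>s > 0\<close> by simp
qed (use assms(1) in \<open>auto simp: singular_space_def ell2_def\<close>)

text \<open>Eigenvectors of T* T for different eigenvalues are orthogonal. Without forming the
  adjoint, the inner product of \<open>T v\<close> and \<open>T w\<close> is evaluated by the
  equation for \<open>v\<close> and, after conjugation, by the one for \<open>w\<close>.\<close>

lemma singular_space_orthogonal:
  assumes v: "v \<in> singular_space A T s" "s > 0" and w: "w \<in> singular_space A T t" "t > 0" and "s \<noteq> t"
  shows "(\<Sum>x\<in>F. v x * cnj (w x)) = 0"
proof -
  have inner: "ell2_inner A f g = cnj (ell2_inner A g f)"
    if "finite B" "B \<subseteq> A" "\<And>x. x \<notin> B \<Longrightarrow> f x = 0" for f g :: "'a \<Rightarrow> complex" and B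
    using ell2_inner_finite_support[OF that(1,2), of f g] ell2_inner_finite_support[OF that(1,2), of g f]
      that(3) by (simp add: cnj_sum mult.commute)
  have mem: "v \<in> ell2 A" "w \<in> ell2 A" using v w by (auto simp: singular_space_def)
  have 1: "ell2_inner A (T v) (T w) = of_real (s\<^sup>2) * ell2_inner A v w"
    using v mem by (auto simp: singular_space_def)
  have "ell2_inner A (T w) (T v) = of_real (t\<^sup>2) * ell2_inner A w v"
    using w mem by (auto simp: singular_space_def)
  then have 2: "ell2_inner A (T v) (T w) = of_real (t\<^sup>2) * ell2_inner A v w"
    using inner[OF K, of "T v" "T w"] inner[OF F, of v w] T singular_space_support[OF v] by simp
  have "(of_real (s\<^sup>2) - of_real (t\<^sup>2)) * ell2_inner A v w = 0"
    by (simp only: left_diff_distrib diff_self flip: 1 2)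
  moreover have "s\<^sup>2 \<noteq> t\<^sup>2" using assms by (simp add: power2_eq_iff_nonneg)
  then have "complex_of_real (s\<^sup>2) - of_real (t\<^sup>2) \<noteq> 0" by (metis of_real_eq_iff right_minus_eq)
  ultimately have "ell2_inner A v w = 0" by simp
  then show ?thesis
    using ell2_inner_finite_support[OF F, of v w] singular_space_support[OF v] by simp
qed

text \<open>One nonzero vector for each singular value gives an orthogonal, hence independent,
  family of functions supported in \<open>F\<close>; such functions form a space of finite
  dimension.\<close>

lemma finite_singular_values: "finite {s \<in> {0<..}. \<exists>v\<in>singular_space A T s. v \<noteq> 0}"
proof -
  interpret V: vector_space fscale by (rule vector_space_fscale)
  define S where "S = {s \<in> {0<..}. \<exists>v\<in>singular_space A T s. v \<noteq> 0}"
  have S_pos: "s > 0" if "s \<in> S" for s using that by (simp add: S_def)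
  have "\<forall>s\<in>S. \<exists>v. v \<in> singular_space A T s \<and> v \<noteq> 0" unfolding S_def by blast
  then obtain v where v: "\<And>s. s \<in> S \<Longrightarrow> v s \<in> singular_space A T s \<and> v s \<noteq> 0" by metis
  let ?i = "\<lambda>f g. \<Sum>x\<in>F. f x * cnj (g x)"
  have supp: "v s x = 0" if "s \<in> S" "x \<notin> F" for s x
    using singular_space_support[of "v s" s x] v S_pos that by blast
  have pos: "?i (v s) (v s) \<noteq> 0" if s: "s \<in> S" for s
  proof
    assume "?i (v s) (v s) = 0"
    then have "complex_of_real (\<Sum>x\<in>F. (cmod (v s x))\<^sup>2) = 0"
      by (simp only: of_real_sum complex_norm_square)
    then have "(\<Sum>x\<in>F. (cmod (v s x))\<^sup>2) = 0" by (simp only: of_real_eq_0_iff)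
    then have "v s x = 0" if "x \<in> F" for x using that F(1) by (simp add: sum_nonneg_eq_0_iff)
    then have "v s = 0" using supp[OF s] by (auto simp: fun_eq_iff)
    then show False using v[OF s] by blast
  qed
  have orth: "?i (v s) (v t) = 0" if "s \<in> S" "t \<in> S" "s \<noteq> t" for s t
    using singular_space_orthogonal[of "v s" s "v t" t] v S_pos that by blast
  have inj: "inj_on v S"
  proof (rule inj_onI, rule ccontr)
    fix s t assume st: "s \<in> S" "t \<in> S" "v s = v t" "s \<noteq> t"
    from orth[OF st(1,2,4)] show False unfolding st(3) using pos[OF st(2)] by contradiction
  qed
  have "V.independent (v ` S)"
    unfolding V.independent_explicit_module
  proof (intro allI impI)
    fix t u f assume t: "finite t" "t \<subseteq> v ` S" "(\<Sum>g\<in>t. fscale (u g) g) = 0" "f \<in> t"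
    have "(\<Sum>g\<in>t. u g * g x) = 0" for x
      using fun_cong[OF t(3), of x] by (simp add: sum_fun_apply fscale_def)
    then have "0 = (\<Sum>x\<in>F. (\<Sum>g\<in>t. u g * g x) * cnj (f x))" by simp
    also have "\<dots> = (\<Sum>g\<in>t. u g * ?i g f)"
      unfolding sum_distrib_left sum_distrib_right mult.assoc by (rule sum.swap)
    also have "\<dots> = (\<Sum>g\<in>{f}. u g * ?i g f)"
    proof (rule sum.mono_neutral_right)
      show "\<forall>g\<in>t - {f}. u g * ?i g f = 0"
      proof
        fix g assume "g \<in> t - {f}"
        then obtain s s' where "s \<in> S" "s' \<in> S" "g = v s" "f = v s'" "s \<noteq> s'" using t(2,4) by blast
        then show "u g * ?i g f = 0" using orth by simp
      qed
    qed (use t(1,4) in auto)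
    finally have "u f * ?i f f = 0" by simp
    moreover have "?i f f \<noteq> 0" using pos t(2,4) by blast
    ultimately show "u f = 0" by simp
  qed
  moreover have "v ` S \<subseteq> V.span (delta ` F)"
  proof
    fix f assume "f \<in> v ` S"
    then obtain s where s: "s \<in> S" "f = v s" by blast
    have "f = (\<Sum>w\<in>F. fscale (f w) (delta w))"
    proof
      fix x
      show "f x = (\<Sum>w\<in>F. fscale (f w) (delta w)) x"
        using supp[OF s(1), of x] F(1) unfolding sum_fun_apply fscale_def delta_def s(2)
        by (cases "x \<in> F") (auto simp: if_distrib cong: if_cong)
    qed
    also have "\<dots> \<in> V.span (delta ` F)"
      by (intro V.span_sum V.span_scale V.span_base) auto
    finally show "f \<in> V.span (delta ` F)" .
  qed
  ultimately have "finite (v ` S)" using V.independent_span_bound[of "delta ` F"] F(1) by blast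
  then have "finite S" using inj by (rule finite_imageD)
  then show ?thesis by (simp add: S_def)
qed

text \<open>Multiplicities vanish off the finite set of singular values, so the sum has finitely
  many nonzero terms for every exponent. For p = \<infinity> compactness is all that is
  required.\<close>

lemma T_schatten: "T \<in> schatten_class p A"
proof -
  interpret V: vector_space fscale by (rule vector_space_fscale)
  let ?S = "{s \<in> {0<..}. \<exists>v\<in>singular_space A T s. v \<noteq> 0}"
  let ?f = "\<lambda>s. real (singular_mult A T s) * s powr real_of_ereal p"
  have "singular_mult A T s = 0" if "s \<in> {0<..} - ?S" for s
  proof -
    have "singular_space A T s \<subseteq> {0}" using that by blast
    then have "singular_space A T s \<subseteq> V.span {}" by simp
    then show ?thesis
      unfolding singular_mult_def using V.dim_le_card[of "singular_space A T s" "{}"] by simp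
  qed
  then have "?f summable_on {0<..} \<longleftrightarrow> ?f summable_on ?S"
    by (intro summable_on_cong_neutral) auto
  then have "?f summable_on {0<..}" using finite_singular_values by simp
  then show ?thesis unfolding schatten_class_def using T_compact by simp
qed

end

section \<open>The gradient map\<close>

context group
begin

abbreviation supp :: "('a \<Rightarrow> complex) \<Rightarrow> 'a set" where
  "supp f \<equiv> {x. f x \<noteq> 0}"

lemma group_algebraD:
  assumes "f \<in> group_algebra G"
  shows "finite (supp f)" "supp f \<subseteq> carrier G"
  using assms by (auto simp: group_algebra_def)

lemma delta_group_algebra: "u \<in> carrier G \<Longrightarrow> delta u \<in> group_algebra G"
  by (auto simp: group_algebra_def delta_def)

lemma supp_delta: "supp (delta u) = {u}"
  by (auto simp: delta_def)

lemma qms_generator_group_algebra: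
  assumes "f \<in> group_algebra G"
  shows "qms_generator \<psi> f \<in> group_algebra G"
proof -
  have "supp (qms_generator \<psi> f) \<subseteq> supp f" by (auto simp: qms_generator_def)
  then show ?thesis using group_algebraD[OF assms] unfolding group_algebra_def
    by (auto intro: finite_subset)
qed

lemma conv_group_algebra:
  assumes "f \<in> group_algebra G" "g \<in> group_algebra G"
  shows "conv G f g \<in> group_algebra G"
proof -
  note f = group_algebraD[OF assms(1)] and g = group_algebraD[OF assms(2)]
  have "supp (conv G f g) \<subseteq> (\<lambda>(y, z). y \<otimes> z) ` (supp f \<times> supp g)"
  proof
    fix x assume "x \<in> supp (conv G f g)"
    then have x: "x \<in> carrier G" "(\<Sum>y | f y \<noteq> 0. f y * g (inv y \<otimes> x)) \<noteq> 0"
      by (auto simp: conv_def split: if_splits)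
    then obtain y where y: "y \<in> supp f" "f y * g (inv y \<otimes> x) \<noteq> 0"
      using sum.not_neutral_contains_not_neutral by blast
    moreover have "y \<otimes> (inv y \<otimes> x) = x" using x(1) y(1) f(2) by (auto simp: m_assoc[symmetric])
    ultimately show "x \<in> (\<lambda>(y, z). y \<otimes> z) ` (supp f \<times> supp g)"
      by (intro image_eqI[of _ _ "(y, inv y \<otimes> x)"]) auto
  qed
  moreover have "finite ((\<lambda>(y, z). y \<otimes> z) ` (supp f \<times> supp g))" using f g by blast
  ultimately have "finite (supp (conv G f g))" by (rule finite_subset)
  moreover have "supp (conv G f g) \<subseteq> carrier G" by (auto simp: conv_def)
  ultimately show ?thesis by (simp add: group_algebra_def)
qed

text \<open>The substitution y = z v^-1 turns the sum over the support of the left factor into one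
  over the support of the right factor. Both are compared with the sum over the union of the two
  index sets, where the additional terms vanish.\<close>

lemma conv_right:
  assumes f: "f \<in> group_algebra G" and g: "g \<in> group_algebra G" and z: "z \<in> carrier G"
  shows "conv G f g z = (\<Sum>v\<in>supp g. f (z \<otimes> inv v) * g v)"
proof -
  note f = group_algebraD[OF f] and g = group_algebraD[OF g]
  let ?h = "\<lambda>v. z \<otimes> inv v"
  have inv_h: "inv (z \<otimes> inv v) \<otimes> z = v" if "v \<in> supp g" for v
  proof -
    have "v \<in> carrier G" using that g(2) by blast
    then show ?thesis using z by (simp add: inv_mult_group m_assoc)
  qed
  then have inj: "inj_on ?h (supp g)" by (rule inj_on_inverseI)
  have "conv G f g z = (\<Sum>y\<in>supp f. f y * g (inv y \<otimes> z))" using z by (simp add: conv_def)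
  also have "\<dots> = (\<Sum>y\<in>supp f \<union> ?h ` supp g. f y * g (inv y \<otimes> z))"
    by (rule sum.mono_neutral_left) (use f g in auto)
  also have "\<dots> = (\<Sum>y\<in>?h ` supp g. f y * g (inv y \<otimes> z))"
  proof (rule sum.mono_neutral_right)
    show "\<forall>y\<in>(supp f \<union> ?h ` supp g) - ?h ` supp g. f y * g (inv y \<otimes> z) = 0"
    proof
      fix y assume y: "y \<in> (supp f \<union> ?h ` supp g) - ?h ` supp g"
      then have "y \<in> carrier G" using f(2) by blast
      then have "y = z \<otimes> inv (inv y \<otimes> z)" using z by (simp add: inv_mult_group m_assoc[symmetric])
      then have "inv y \<otimes> z \<notin> supp g" using y by blast
      then show "f y * g (inv y \<otimes> z) = 0" by simp
    qed
  qed (use f g in auto)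
  also have "\<dots> = (\<Sum>v\<in>supp g. f (?h v) * g (inv (?h v) \<otimes> z))"
    by (simp add: sum.reindex[OF inj])
  also have "\<dots> = (\<Sum>v\<in>supp g. f (z \<otimes> inv v) * g v)"
    by (rule sum.cong) (use inv_h in auto)
  finally show ?thesis .
qed

text \<open>A group algebra element and its vector in \<open>ell2\<close> are the same function, so
  the \<open>delta\<close> in \<open>gradient_schatten\<close> can be removed.\<close>

lemma conv_delta_one:
  assumes "f \<in> group_algebra G"
  shows "conv G f (delta \<one>) = f"
proof
  fix z
  show "conv G f (delta \<one>) z = f z"
  proof (cases "z \<in> carrier G")
    case True
    then show ?thesis
      using conv_right[OF assms delta_group_algebra[of \<one>] True] by (simp add: supp_delta) (simp add: delta_def)
  next
    case False
    then show ?thesis using group_algebraD(2)[OF assms] by (auto simp: conv_def)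
  qed
qed

lemma gradient_map_group_algebra:
  assumes "a \<in> group_algebra G" "b \<in> group_algebra G" "x \<in> group_algebra G"
  shows "gradient_map G \<psi> a b x \<in> group_algebra G"
proof -
  have add: "f + g \<in> group_algebra G" "f - g \<in> group_algebra G"
    if "f \<in> group_algebra G" "g \<in> group_algebra G" for f g
  proof -
    have "supp (f + g) \<subseteq> supp f \<union> supp g" "supp (f - g) \<subseteq> supp f \<union> supp g" by auto
    then show "f + g \<in> group_algebra G" "f - g \<in> group_algebra G"
      using that unfolding group_algebra_def by (auto intro: finite_subset)
  qed
  show ?thesis
    unfolding gradient_map_def
    by (intro add conv_group_algebra qms_generator_group_algebra assms)
qed

text \<open>For given u and v the only w contributing at z = u w v is u^-1 z v^-1. The four terms of
  the gradient map weight it by the lengths of u w v, w, u w and w v, the last two being z v^-1 and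
  u^-1 z.\<close>

lemma gradient_map_eq:
  assumes a: "a \<in> group_algebra G" and b: "b \<in> group_algebra G" and x: "x \<in> group_algebra G"
  shows "gradient_map G \<psi> a b x z = (if z \<in> carrier G
    then \<Sum>u\<in>supp a. \<Sum>v\<in>supp b. a u * b v *
      of_int (gradient_coeff G \<psi> u v (inv u \<otimes> z \<otimes> inv v)) * x (inv u \<otimes> z \<otimes> inv v) else 0)"
proof (cases "z \<in> carrier G")
  case z [simp]: True
  note a' = group_algebraD[OF a] and b' = group_algebraD[OF b]
  let ?w = "\<lambda>u v. inv u \<otimes> z \<otimes> inv v"
  have left: "conv G (conv G a y) b z = (\<Sum>u\<in>supp a. \<Sum>v\<in>supp b. a u * b v * y (?w u v))"
    if y: "y \<in> group_algebra G" for y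
  proof -
    have "conv G (conv G a y) b z = (\<Sum>v\<in>supp b. conv G a y (z \<otimes> inv v) * b v)"
      by (rule conv_right) (use conv_group_algebra a b y in auto)
    also have "\<dots> = (\<Sum>v\<in>supp b. \<Sum>u\<in>supp a. a u * b v * y (?w u v))"
    proof (rule sum.cong)
      fix v assume "v \<in> supp b"
      then have [simp]: "v \<in> carrier G" using b'(2) by blast
      have "conv G a y (z \<otimes> inv v) * b v = (\<Sum>u\<in>supp a. a u * y (inv u \<otimes> (z \<otimes> inv v)) * b v)"
        by (simp add: conv_def sum_distrib_right)
      also have "\<dots> = (\<Sum>u\<in>supp a. a u * b v * y (?w u v))"
      proof (rule sum.cong)
        fix u assume "u \<in> supp a"
        then have "u \<in> carrier G" using a'(2) by blast
        then show "a u * y (inv u \<otimes> (z \<otimes> inv v)) * b v = a u * b v * y (?w u v)"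
          by (simp add: m_assoc mult_ac)
      qed simp
      finally show "conv G a y (z \<otimes> inv v) * b v = (\<Sum>u\<in>supp a. a u * b v * y (?w u v))" .
    qed simp
    also have "\<dots> = (\<Sum>u\<in>supp a. \<Sum>v\<in>supp b. a u * b v * y (?w u v))" by (rule sum.swap)
    finally show ?thesis .
  qed
  have right: "conv G a (qms_generator \<psi> (conv G x b)) z =
      (\<Sum>u\<in>supp a. \<Sum>v\<in>supp b. of_nat (\<psi> (inv u \<otimes> z)) * (a u * b v * x (?w u v)))"
  proof -
    have "conv G a (qms_generator \<psi> (conv G x b)) z =
        (\<Sum>u\<in>supp a. a u * (of_nat (\<psi> (inv u \<otimes> z)) * conv G x b (inv u \<otimes> z)))"
      by (simp add: conv_def[of G a] qms_generator_def)
    also have "\<dots> = (\<Sum>u\<in>supp a. \<Sum>v\<in>supp b. of_nat (\<psi> (inv u \<otimes> z)) * (a u * b v * x (?w u v)))"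
    proof (rule sum.cong)
      fix u assume "u \<in> supp a"
      then have uz: "inv u \<otimes> z \<in> carrier G" using a'(2) z by blast
      show "a u * (of_nat (\<psi> (inv u \<otimes> z)) * conv G x b (inv u \<otimes> z)) =
          (\<Sum>v\<in>supp b. of_nat (\<psi> (inv u \<otimes> z)) * (a u * b v * x (?w u v)))"
        unfolding conv_right[OF x b uz] sum_distrib_left
        by (intro sum.cong HOL.refl) (simp only: mult_ac)
    qed simp
    finally show ?thesis .
  qed
  have mid: "conv G (qms_generator \<psi> (conv G a x)) b z =
      (\<Sum>u\<in>supp a. \<Sum>v\<in>supp b. of_nat (\<psi> (z \<otimes> inv v)) * (a u * b v * x (?w u v)))"
  proof -
    have "conv G (qms_generator \<psi> (conv G a x)) b z =
        (\<Sum>v\<in>supp b. of_nat (\<psi> (z \<otimes> inv v)) * conv G a x (z \<otimes> inv v) * b v)"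
      using conv_right[OF qms_generator_group_algebra[OF conv_group_algebra[OF a x]] b z]
      by (simp add: qms_generator_def)
    also have "\<dots> = (\<Sum>v\<in>supp b. \<Sum>u\<in>supp a. of_nat (\<psi> (z \<otimes> inv v)) * (a u * b v * x (?w u v)))"
    proof (rule sum.cong)
      fix v assume "v \<in> supp b"
      then have [simp]: "v \<in> carrier G" using b'(2) by blast
      have "of_nat (\<psi> (z \<otimes> inv v)) * conv G a x (z \<otimes> inv v) * b v =
          (\<Sum>u\<in>supp a. of_nat (\<psi> (z \<otimes> inv v)) * (a u * x (inv u \<otimes> (z \<otimes> inv v))) * b v)"
        by (simp add: conv_def sum_distrib_right sum_distrib_left)
      also have "\<dots> = (\<Sum>u\<in>supp a. of_nat (\<psi> (z \<otimes> inv v)) * (a u * b v * x (?w u v)))"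
      proof (rule sum.cong)
        fix u assume "u \<in> supp a"
        then have "u \<in> carrier G" using a'(2) by blast
        then show "of_nat (\<psi> (z \<otimes> inv v)) * (a u * x (inv u \<otimes> (z \<otimes> inv v))) * b v =
            of_nat (\<psi> (z \<otimes> inv v)) * (a u * b v * x (?w u v))"
          by (simp add: m_assoc mult_ac)
      qed simp
      finally show "of_nat (\<psi> (z \<otimes> inv v)) * conv G a x (z \<otimes> inv v) * b v =
          (\<Sum>u\<in>supp a. of_nat (\<psi> (z \<otimes> inv v)) * (a u * b v * x (?w u v)))" .
    qed simp
    also have "\<dots> = (\<Sum>u\<in>supp a. \<Sum>v\<in>supp b. of_nat (\<psi> (z \<otimes> inv v)) * (a u * b v * x (?w u v)))"
      by (rule sum.swap)
    finally show ?thesis .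
  qed
  have "gradient_map G \<psi> a b x z =
      of_nat (\<psi> z) * (\<Sum>u\<in>supp a. \<Sum>v\<in>supp b. a u * b v * x (?w u v))
      + (\<Sum>u\<in>supp a. \<Sum>v\<in>supp b. a u * b v * (of_nat (\<psi> (?w u v)) * x (?w u v)))
      - (\<Sum>u\<in>supp a. \<Sum>v\<in>supp b. of_nat (\<psi> (z \<otimes> inv v)) * (a u * b v * x (?w u v)))
      - (\<Sum>u\<in>supp a. \<Sum>v\<in>supp b. of_nat (\<psi> (inv u \<otimes> z)) * (a u * b v * x (?w u v)))"
    using left[OF qms_generator_group_algebra[OF x]]
    by (simp add: gradient_map_def mid right qms_generator_def[of _ "conv G (conv G a x) b"] left[OF x]
        qms_generator_def[of _ x])
  also have "\<dots> = (\<Sum>u\<in>supp a. \<Sum>v\<in>supp b.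
      (of_nat (\<psi> z) + of_nat (\<psi> (?w u v)) - of_nat (\<psi> (z \<otimes> inv v)) - of_nat (\<psi> (inv u \<otimes> z)))
      * (a u * b v * x (?w u v)))"
    by (simp add: sum_distrib_left sum.distrib[symmetric] sum_subtractf[symmetric] algebra_simps)
  also have "\<dots> = (\<Sum>u\<in>supp a. \<Sum>v\<in>supp b. a u * b v *
      of_int (gradient_coeff G \<psi> u v (?w u v)) * x (?w u v))"
  proof (intro sum.cong HOL.refl)
    fix u v assume "u \<in> supp a" "v \<in> supp b"
    then have [simp]: "u \<in> carrier G" "v \<in> carrier G" using a'(2) b'(2) by blast+
    have uw: "u \<otimes> ?w u v = z \<otimes> inv v" by (simp add: m_assoc[symmetric])
    have wv: "?w u v \<otimes> v = inv u \<otimes> z" by (simp add: m_assoc)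
    have "gradient_coeff G \<psi> u v (?w u v) =
        int (\<psi> z) + int (\<psi> (?w u v)) - int (\<psi> (z \<otimes> inv v)) - int (\<psi> (inv u \<otimes> z))"
      unfolding gradient_coeff_def uw wv by (simp add: m_assoc)
    then have "complex_of_int (gradient_coeff G \<psi> u v (?w u v)) =
        of_nat (\<psi> z) + of_nat (\<psi> (?w u v)) - of_nat (\<psi> (z \<otimes> inv v)) - of_nat (\<psi> (inv u \<otimes> z))"
      by simp
    then show "(of_nat (\<psi> z) + of_nat (\<psi> (?w u v)) - of_nat (\<psi> (z \<otimes> inv v)) - of_nat (\<psi> (inv u \<otimes> z)))
        * (a u * b v * x (?w u v)) =
        a u * b v * of_int (gradient_coeff G \<psi> u v (?w u v)) * x (?w u v)"
      by (simp only: mult_ac)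
  qed
  finally show ?thesis by simp
qed (simp add: gradient_map_def conv_def qms_generator_def)

section \<open>The gradient-Schatten property as finiteness of the supports\<close>

lemma gradient_schatten_if_finite_support:
  assumes fin: "\<And>u v. u \<in> carrier G \<Longrightarrow> v \<in> carrier G \<Longrightarrow>
      finite {w \<in> carrier G. gradient_coeff G \<psi> u v w \<noteq> 0}"
  shows "gradient_schatten p G \<psi>"
  unfolding gradient_schatten_def
proof (intro ballI)
  fix a b assume a: "a \<in> group_algebra G" and b: "b \<in> group_algebra G"
  note a' = group_algebraD[OF a] and b' = group_algebraD[OF b]
  let ?w = "\<lambda>u v z. inv u \<otimes> z \<otimes> inv v"
  let ?c = "\<lambda>u v w. complex_of_int (gradient_coeff G \<psi> u v w)"
  \<comment> \<open>\<open>F\<close> collects the basis vectors that some pair u, v does not kill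
    and \<open>K\<close> contains all places to which they are moved. The entry \<open>k z w\<close>
    adds up the pairs with u w v = z.\<close>
  define F where "F = (\<Union>u\<in>supp a. \<Union>v\<in>supp b. {w \<in> carrier G. gradient_coeff G \<psi> u v w \<noteq> 0})"
  define K where "K = (\<lambda>(u, w, v). u \<otimes> w \<otimes> v) ` (supp a \<times> F \<times> supp b)"
  define k where "k z w = (\<Sum>u\<in>supp a. \<Sum>v\<in>supp b. if w = ?w u v z then a u * b v * ?c u v w else 0)"
    for z w
  define T where "T f z = (if z \<in> K then \<Sum>w\<in>F. k z w * f w else 0)" for f z
  have F: "finite F" "F \<subseteq> carrier G"
  proof -
    have "finite {w \<in> carrier G. gradient_coeff G \<psi> u v w \<noteq> 0}" if "u \<in> supp a" "v \<in> supp b" for u v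
      using fin that a'(2) b'(2) by blast
    then show "finite F" unfolding F_def using a'(1) b'(1) by blast
  qed (auto simp: F_def)
  have K: "finite K" using F(1) a'(1) b'(1) by (simp add: K_def)
  have KG: "K \<subseteq> carrier G"
    using F(2) a'(2) b'(2) unfolding K_def by (auto intro!: m_closed)
  interpret finite_kernel "carrier G" F K k T
    by unfold_locales (use F K KG T_def in auto)
  have T_eq: "T x = gradient_map G \<psi> a b x" if x: "x \<in> group_algebra G" for x
  proof
    fix z
    have "T x z = (\<Sum>u\<in>supp a. \<Sum>v\<in>supp b. a u * b v * ?c u v (?w u v z) * x (?w u v z))"
      if z: "z \<in> carrier G"
    proof (cases "z \<in> K")
      case True
      have "T x z = (\<Sum>w\<in>F. \<Sum>u\<in>supp a. \<Sum>v\<in>supp b.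
          if w = ?w u v z then a u * b v * ?c u v w * x w else 0)"
        using True by (simp add: T_def k_def sum_distrib_right if_distrib[of "\<lambda>t. t * _"] cong: if_cong)
      also have "\<dots> = (\<Sum>u\<in>supp a. \<Sum>w\<in>F. \<Sum>v\<in>supp b.
          if w = ?w u v z then a u * b v * ?c u v w * x w else 0)"
        by (rule sum.swap)
      also have "\<dots> = (\<Sum>u\<in>supp a. \<Sum>v\<in>supp b. \<Sum>w\<in>F.
          if w = ?w u v z then a u * b v * ?c u v w * x w else 0)"
        by (rule sum.cong[OF HOL.refl], rule sum.swap)
      also have "\<dots> = (\<Sum>u\<in>supp a. \<Sum>v\<in>supp b. a u * b v * ?c u v (?w u v z) * x (?w u v z))"
      proof (intro sum.cong HOL.refl)
        fix u v assume uv: "u \<in> supp a" "v \<in> supp b"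
        then have "u \<in> carrier G" "v \<in> carrier G" using a'(2) b'(2) by blast+
        then have "?w u v z \<notin> F \<Longrightarrow> gradient_coeff G \<psi> u v (?w u v z) = 0"
          unfolding F_def using uv z by auto
        then show "(\<Sum>w\<in>F. if w = ?w u v z then a u * b v * ?c u v w * x w else 0) =
            a u * b v * ?c u v (?w u v z) * x (?w u v z)"
          using F(1) by (cases "?w u v z \<in> F") (auto simp: sum.delta')
      qed
      finally show ?thesis .
    next
      case False
      have "gradient_coeff G \<psi> u v (?w u v z) = 0" if uv: "u \<in> supp a" "v \<in> supp b" for u v
      proof (rule ccontr)
        assume nz: "gradient_coeff G \<psi> u v (?w u v z) \<noteq> 0"
        have [simp]: "u \<in> carrier G" "v \<in> carrier G" using uv a'(2) b'(2) by blast+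
        have "?w u v z \<in> F" unfolding F_def using uv z nz by auto
        moreover have "u \<otimes> ?w u v z \<otimes> v = z" using z
          by (simp add: m_assoc) (simp add: m_assoc[symmetric])
        ultimately have "z \<in> K"
          unfolding K_def using uv by (intro image_eqI[of _ _ "(u, ?w u v z, v)"]) auto
        then show False using False by blast
      qed
      then show ?thesis using False by (simp add: T_def)
    qed
    moreover have "T x z = 0" if "z \<notin> carrier G" using that KG by (auto simp: T_def)
    ultimately show "T x z = gradient_map G \<psi> a b x z"
      unfolding gradient_map_eq[OF a b x] by simp
  qed
  have "T (conv G x (delta \<one>)) = conv G (gradient_map G \<psi> a b x) (delta \<one>)"
    if x: "x \<in> group_algebra G" for x
    by (simp only: conv_delta_one x gradient_map_group_algebra[OF a b x] T_eq[OF x])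
  then show "\<exists>T\<in>schatten_class p (carrier G). \<forall>x\<in>group_algebra G.
      T (conv G x (delta \<one>)) = conv G (gradient_map G \<psi> a b x) (delta \<one>)"
    using T_schatten by blast
qed

text \<open>The basis vectors \<open>\<delta>\<^sub>w\<close> are mapped to orthogonal vectors with integer norms, so a compact
  operator sends all but finitely many of them to 0.\<close>

lemma finite_support_if_gradient_schatten:
  assumes "gradient_schatten p G \<psi>" and u: "u \<in> carrier G" and v: "v \<in> carrier G"
  shows "finite {w \<in> carrier G. gradient_coeff G \<psi> u v w \<noteq> 0}"
proof (rule ccontr)
  let ?N = "{w \<in> carrier G. gradient_coeff G \<psi> u v w \<noteq> 0}"
  assume "infinite ?N"
  then obtain ws :: "nat \<Rightarrow> 'a" where ws: "inj ws" "range ws \<subseteq> ?N"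
    using infinite_countable_subset by blast
  have wG: "ws n \<in> carrier G" and nz: "gradient_coeff G \<psi> u v (ws n) \<noteq> 0" for n using ws(2) by auto
  obtain T where T: "T \<in> schatten_class p (carrier G)"
    "\<And>x. x \<in> group_algebra G \<Longrightarrow>
      T (conv G x (delta \<one>)) = conv G (gradient_map G \<psi> (delta u) (delta v) x) (delta \<one>)"
    using assms(1) delta_group_algebra[OF u] delta_group_algebra[OF v]
    unfolding gradient_schatten_def by blast
  have compact: "T \<in> compact_ops (carrier G)"
    using T(1) by (auto simp: schatten_class_def split: if_splits)
  define y where "y n = u \<otimes> ws n \<otimes> v" for n
  have yG: "y n \<in> carrier G" for n using u v wG by (simp add: y_def)
  have "inj y"
  proof (rule injI)
    fix m n assume "y m = y n"
    then have "ws m = ws n" using u v wG by (simp add: y_def)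
    then show "m = n" using ws(1) by (simp add: inj_eq)
  qed
  have T_delta: "T (delta (ws n)) (y n) = of_int (gradient_coeff G \<psi> u v (ws n))" for n
  proof -
    let ?g = "gradient_map G \<psi> (delta u) (delta v) (delta (ws n))"
    have "inv u \<otimes> y n \<otimes> inv v = ws n"
      using u v wG by (simp add: y_def m_assoc) (simp add: m_assoc[symmetric])
    then have val: "?g (y n) = of_int (gradient_coeff G \<psi> u v (ws n))"
      using gradient_map_eq[OF delta_group_algebra[OF u] delta_group_algebra[OF v]
          delta_group_algebra[OF wG], of \<psi> n "y n"] yG
      by (simp add: supp_delta) (simp add: delta_def)
    have "?g \<in> group_algebra G"
      by (intro gradient_map_group_algebra delta_group_algebra u v wG)
    then have "T (delta (ws n)) = ?g"
      using T(2)[OF delta_group_algebra[OF wG]] conv_delta_one[OF delta_group_algebra[OF wG]]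
        conv_delta_one[of ?g] by simp
    then show ?thesis using val by simp
  qed
  have ell2_delta: "delta (ws n) \<in> ell2 (carrier G)" "ell2_norm (carrier G) (delta (ws n)) \<le> 1" for n
    using ell2_finite_support[of "{ws n}" "carrier G" "delta (ws n)"] wG by (auto simp: delta_def)
  obtain g r where g: "g \<in> ell2 (carrier G)" "strict_mono (r :: nat \<Rightarrow> nat)"
    "(\<lambda>n. ell2_norm (carrier G) (T (delta (ws (r n))) - g)) \<longlonglongrightarrow> 0"
    using compact ell2_delta unfolding compact_ops_def by (auto dest!: spec[of _ "\<lambda>n. delta (ws n)"])
  \<comment> \<open>Only the coordinate at \<open>y (r n)\<close> is examined: there the limit
    \<open>g\<close> becomes small, whereas the image of the basis vector has a nonzero integer
    value.\<close>
  have "(\<lambda>n. cmod (g (y (r n)))) \<longlonglongrightarrow> 0"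
  proof (rule ell2_tendsto_0_along[OF g(1)])
    show "inj (\<lambda>n. y (r n))"
      using inj_compose[OF \<open>inj y\<close> strict_mono_imp_inj_on[OF g(2)]] by (simp add: o_def)
  qed (use yG in auto)
  then have "(\<lambda>n. ell2_norm (carrier G) (T (delta (ws (r n))) - g) + cmod (g (y (r n)))) \<longlonglongrightarrow> 0"
    using tendsto_add[OF g(3)] by fastforce
  then have "\<forall>\<^sub>F n in sequentially.
      ell2_norm (carrier G) (T (delta (ws (r n))) - g) + cmod (g (y (r n))) < 1"
    by (rule order_tendstoD) simp
  then obtain n where n: "ell2_norm (carrier G) (T (delta (ws (r n))) - g) + cmod (g (y (r n))) < 1"
    using eventually_happens'[OF sequentially_bot] by blast
  have "T (delta (ws (r n))) \<in> ell2 (carrier G)"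
    using compact ell2_delta(1) unfolding compact_ops_def bounded_ops_def by blast
  then have "cmod ((T (delta (ws (r n))) - g) (y (r n))) \<le> ell2_norm (carrier G) (T (delta (ws (r n))) - g)"
    by (intro ell2_norm_coord ell2_diff g(1))
  moreover have "1 \<le> cmod (T (delta (ws (r n))) (y (r n)))"
    using nz[of "r n"] unfolding T_delta by (simp add: norm_of_int)
  moreover have "cmod (T (delta (ws (r n))) (y (r n))) \<le>
      cmod ((T (delta (ws (r n))) - g) (y (r n))) + cmod (g (y (r n)))"
    using norm_triangle_ineq[of "(T (delta (ws (r n))) - g) (y (r n))" "g (y (r n))"] by simp
  ultimately show False using n by linarith
qed

lemma gradient_schatten_iff:
  "gradient_schatten p G \<psi> \<longleftrightarrow>
    (\<forall>u\<in>carrier G. \<forall>v\<in>carrier G. finite {w \<in> carrier G. gradient_coeff G \<psi> u v w \<noteq> 0})"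
  using gradient_schatten_if_finite_support finite_support_if_gradient_schatten by blast

end

theorem theorem1p3:
  fixes S :: "'s set" and M :: "'s \<Rightarrow> 's \<Rightarrow> enat" and p :: ereal
  assumes "finite S" and "coxeter_matrix S M" and "1 \<le> p"
  defines "W \<equiv> coxeter_group S M"
  shows
    "(gradient_schatten p W (word_length W (coxeter_gens S M)) \<longleftrightarrow>
        (\<forall>s\<in>S. \<forall>t\<in>S. finite {w \<in> carrier W.
          w \<otimes>\<^bsub>W\<^esub> coxeter_gen S M s = coxeter_gen S M t \<otimes>\<^bsub>W\<^esub> w}))
     \<and> ((\<forall>s\<in>S. \<forall>t\<in>S. finite {w \<in> carrier W.
          w \<otimes>\<^bsub>W\<^esub> coxeter_gen S M s = coxeter_gen S M t \<otimes>\<^bsub>W\<^esub> w})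
        \<longleftrightarrow> small_at_infinity W (coxeter_gens S M))"
proof -
  interpret exchange_group W "coxeter_gens S M"
    unfolding W_def using assms(1,2) by (intro exchange_group_coxeter)
  have "(\<forall>s\<in>S. \<forall>t\<in>S. finite {w \<in> carrier W.
          w \<otimes>\<^bsub>W\<^esub> coxeter_gen S M s = coxeter_gen S M t \<otimes>\<^bsub>W\<^esub> w}) \<longleftrightarrow>
      (\<forall>s\<in>coxeter_gens S M. \<forall>t\<in>coxeter_gens S M. finite {w \<in> carrier W. w \<otimes>\<^bsub>W\<^esub> s = t \<otimes>\<^bsub>W\<^esub> w})"
    by (simp add: coxeter_gens_def)
  then show ?thesis
    unfolding gradient_schatten_iff small_at_infinity_iff finite_gradient_support_iff by blast
qed

end
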